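(* Let $z>0$ be a real number. Let $F(a,b,z)$ be the free energy of the monopole-dimer model on the square grid with edge weights $a,b>0$ and vertex weights $z$, and let the entropy be $$S(a,b,z)=F(a,b,z)-z\ln z\,\frac{\partial}{\partial z}F(a,b,z).$$ Then, in the case of equal dimer weights $a=b=1$, $$S(1,1,z)=F(1,1,z)-\frac{2z^2\ln z}{\pi(4+z^2)}\,K\!\left(\frac{4}{4+z^2}\right),$$ where $K(k)=\int_0^{\pi/2}\frac{dt}{\sqrt{1-k^2\sin^2t}}$ is the complete elliptic integral of the first kind with modulus $k$.
   Context: The free energy is $$F(a,b,z)=\lim_{\substack{m,n\to\infty\\ m,n\text{ even}}}\frac1{mn}\ln Z_{m,n},$$ where $Z_{m,n}$ is the partition function of the monopole-dimer model on the grid graph $Q_{m,n}$, defined as follows. Grid graph: $Q_{m,n}$ has vertex set $\{(i,j): 1\le i\le m,\ 1\le j\le n\}$ with its standard planar embedding as points of $\mathbb{Z}^2$. Edges $\{(i,j),(i,j+1)\}$ have weight $a$, edges $\{(i,j),(i+1,j)\}$ have weight $b$, and every vertex has weight $z$. Monopole-dimer configuration on a plane graph $G=[V,E]$: a collection $C$ of pairwise vertex-disjoint directed loops of even length in $G$, where a loop of length $2$ is a doubled edge (exactly one such loop for each edge) and a loop of length $2k\ge4$ is a directed simple cycle (so each undirected cycle gives two distinct directed loops). Every vertex is either isolated (a monopole) or belongs to exactly one loop. Weights: the weight of a loop $\ell$ is $w(\ell)=(-1)^{N(\ell)}$ times the product of the weights of the edges traversed by $\ell$ (for a doubled edge, the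 square of the edge weight), where $N(\ell)$ is the number of vertices of $V$ strictly enclosed by $\ell$. The weight $w(C)$ is the product of $w(\ell)$ over the loops $\ell$ of $C$ and of the vertex weights over the isolated vertices of $C$. The partition function is $Z=\sum_C w(C)$, summed over all monopole-dimer configurations. *)

theory Defs
  imports "HOL-Analysis.Analysis"
begin

section \<open>Monopole-dimer model on a straight-line plane graph\<close>

record 'v weighted_plane_graph =
  verts :: "'v set"
  edges :: "'v set set"
  place :: "'v \<Rightarrow> complex"
  edge_weight :: "'v set \<Rightarrow> real"
  vertex_weight :: "'v \<Rightarrow> real"

definition cycle_arcs :: "'v list \<Rightarrow> ('v \<times> 'v) set" where
  "cycle_arcs vs = set (zip vs (rotate1 vs))"

text \<open>A directed loop is represented by its set of arcs. For \<open>vs = [u, v]\<close> this is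
  \<open>{(u, v), (v, u)}\<close>, so a doubled edge yields exactly one loop, whereas the two orientations of a
  longer cycle have different arc sets.\<close>

definition directed_loop :: "('v, 'b) weighted_plane_graph_scheme \<Rightarrow> ('v \<times> 'v) set \<Rightarrow> bool" where
  "directed_loop G l \<longleftrightarrow>
     (\<exists>vs. distinct vs \<and> set vs \<subseteq> verts G \<and> length vs \<ge> 2 \<and> even (length vs) \<and>
           l = cycle_arcs vs \<and> (\<forall>(u, v) \<in> l. {u, v} \<in> edges G))"

definition loop_curve :: "('v, 'b) weighted_plane_graph_scheme \<Rightarrow> ('v \<times> 'v) set \<Rightarrow> complex set" where
  "loop_curve G l = (\<Union>(u, v) \<in> l. closed_segment (place G u) (place G v))"

definition num_enclosed :: "('v, 'b) weighted_plane_graph_scheme \<Rightarrow> ('v \<times> 'v) set \<Rightarrow> nat" where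
  "num_enclosed G l = card {v \<in> verts G. place G v \<in> inside (loop_curve G l)}"

text \<open>The product runs over arcs, so a doubled edge contributes the square of its weight.\<close>

definition loop_weight :: "('v, 'b) weighted_plane_graph_scheme \<Rightarrow> ('v \<times> 'v) set \<Rightarrow> real" where
  "loop_weight G l = (-1) ^ num_enclosed G l * (\<Prod>(u, v) \<in> l. edge_weight G {u, v})"

definition configuration ::
    "('v, 'b) weighted_plane_graph_scheme \<Rightarrow> ('v \<times> 'v) set set \<Rightarrow> bool" where
  "configuration G C \<longleftrightarrow>
     (\<forall>l \<in> C. directed_loop G l) \<and>
     (\<forall>l \<in> C. \<forall>l' \<in> C. l \<noteq> l' \<longrightarrow> Field l \<inter> Field l' = {})"

definition monopoles :: "('v, 'b) weighted_plane_graph_scheme \<Rightarrow> ('v \<times> 'v) set set \<Rightarrow> 'v set" where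
  "monopoles G C = verts G - (\<Union>l \<in> C. Field l)"

definition configuration_weight ::
    "('v, 'b) weighted_plane_graph_scheme \<Rightarrow> ('v \<times> 'v) set set \<Rightarrow> real" where
  "configuration_weight G C =
     (\<Prod>l \<in> C. loop_weight G l) * (\<Prod>v \<in> monopoles G C. vertex_weight G v)"

definition partition_function :: "('v, 'b) weighted_plane_graph_scheme \<Rightarrow> real" where
  "partition_function G = (\<Sum>C | configuration G C. configuration_weight G C)"


section \<open>Grid graphs, free energy and entropy\<close>

definition grid_graph ::
    "nat \<Rightarrow> nat \<Rightarrow> real \<Rightarrow> real \<Rightarrow> real \<Rightarrow> (nat \<times> nat) weighted_plane_graph" where
  "grid_graph m n a b z =
     \<lparr>verts = {1..m} \<times> {1..n},
      edges = {{(i, j), (i, j + 1)} | i j. i \<in> {1..m} \<and> j \<in> {1..n} \<and> j + 1 \<in> {1..n}} \<union>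
              {{(i, j), (i + 1, j)} | i j. i \<in> {1..m} \<and> i + 1 \<in> {1..m} \<and> j \<in> {1..n}},
      place = (\<lambda>(i, j). Complex (real i) (real j)),
      edge_weight = (\<lambda>e. if \<exists>i j. e = {(i, j), (i, j + 1)} then a else b),
      vertex_weight = (\<lambda>_. z)\<rparr>"

definition grid_partition_function :: "nat \<Rightarrow> nat \<Rightarrow> real \<Rightarrow> real \<Rightarrow> real \<Rightarrow> real" where
  "grid_partition_function m n a b z = partition_function (grid_graph m n a b z)"

definition both_even_at_top :: "(nat \<times> nat) filter" where
  "both_even_at_top =
     inf (sequentially \<times>\<^sub>F sequentially) (principal {(m, n). even m \<and> even n})"

definition free_energy :: "real \<Rightarrow> real \<Rightarrow> real \<Rightarrow> real" where
  "free_energy a b z =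
     Lim both_even_at_top
       (\<lambda>(m, n). ln (grid_partition_function m n a b z) / (real m * real n))"

definition entropy :: "real \<Rightarrow> real \<Rightarrow> real \<Rightarrow> real" where
  "entropy a b z = free_energy a b z - z * ln z * deriv (\<lambda>x. free_energy a b x) z"

text \<open>The argument is the modulus \<open>k\<close>, not the parameter \<open>k\<^sup>2\<close>.\<close>

definition complete_elliptic_K :: "real \<Rightarrow> real" where
  "complete_elliptic_K k = integral {0..pi / 2} (\<lambda>t. 1 / sqrt (1 - k\<^sup>2 * (sin t)\<^sup>2))"

end

(*
  The determinant of zI + A, where A is the adjacency matrix of the grid with Kasteleyn signs, expands
  over the monopole-dimer configurations: a permutation contributes only if its cycles run along edges,
  and the sign of a cycle agrees with (-1)^(number of enclosed vertices) in its weight. This sign rule is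
  proved by shrinking cycles combinatorially, with "enclosed" replaced by the parity of crossings of a
  ray; the Jordan curve theorem identifies that parity with the topological inside.

  A is skew and its horizontal and vertical parts anticommute, so the square of the determinant is the
  product of z^2 + 4 cos^2 + 4 cos^2 over the standing waves of the grid, and F is a double integral of
  ln (z^2 + 4 cos^2 x + 4 cos^2 y). Differentiating in z and rotating the torus by 45 degrees leaves a
  complete elliptic integral.
*)
theory Submission
  imports Defs "HOL-Combinatorics.Combinatorics" "Jordan_Normal_Form.Determinant"
begin

section \<open>Signs of cycles in the square grid\<close>

text \<open>The minus sign in the orientation rule for cycles is the one a determinant asks for: the
  grid is bipartite, so every nontrivial cycle of a contributing permutation has even length and
  sign -1, and the two minus signs leave (-1)^(number of enclosed vertices). Flipping or cutting a
  cycle changes crossing counts by plain arithmetic, whereas topological interiors would call for a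
  Jordan argument at each reduction; with parities, one such argument at the end suffices.

  The obstacle to the diagonalisation is that A is real and skew, so outside its kernel it has no
  real eigenvectors. It also takes differences of neighbours where sines need sums, and its vertical
  signs alternate from column to column. Signs of period four in each coordinate turn differences
  into sums; the alternation is harmless in A^2, where the mixed terms cancel. Hence the detour
  through K K^T = z^2 I - A^2 with K = zI + A.

  For z > 0 the argument of the logarithm stays above z^2, so the symbol is Lipschitz and the double
  Riemann sum has an error of order m + n, negligible against mn.\<close>

fun path_arcs :: "'a list \<Rightarrow> ('a \<times> 'a) list" where
  "path_arcs (x # y # r) = (x, y) # path_arcs (y # r)"
| "path_arcs _ = []"

abbreviation cyclic_arcs :: "'a list \<Rightarrow> ('a \<times> 'a) list" where
  "cyclic_arcs vs \<equiv> zip vs (rotate1 vs)"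

lemma path_arcs_snoc: "path_arcs (x # r @ [y]) = zip (x # r) (r @ [y])"
  by (induction r arbitrary: x) auto

lemma path_arcs_append: "path_arcs (xs @ w # ys) = path_arcs (xs @ [w]) @ path_arcs (w # ys)"
proof (induction xs)
  case (Cons a xs)
  then show ?case by (cases xs) auto
qed simp

lemma path_arcs_Cons: "t \<noteq> [] \<Longrightarrow> path_arcs (x # t) = (x, hd t) # path_arcs t"
  by (cases t) auto

lemma path_arcs_append_single: "t \<noteq> [] \<Longrightarrow> path_arcs (t @ [x]) = path_arcs t @ [(last t, x)]"
  by (induction t rule: path_arcs.induct) auto

lemma path_arcs_rev: "path_arcs (rev t) = rev (map prod.swap (path_arcs t))"
proof (induction t rule: path_arcs.induct)
  case (1 x y r)
  then show ?case using path_arcs_append_single[of "rev r @ [y]" x] by simp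
qed auto

lemma cyclic_arcs_eq: "vs \<noteq> [] \<Longrightarrow> cyclic_arcs vs = path_arcs (vs @ [hd vs])"
  by (cases vs) (auto simp: path_arcs_snoc)

lemma cyclic_arcs_Cons:
  "t \<noteq> [] \<Longrightarrow> cyclic_arcs (x # t) = (x, hd t) # path_arcs t @ [(last t, x)]"
  using path_arcs_Cons[of "t @ [x]" x] path_arcs_append_single[of t x]
  by (subst cyclic_arcs_eq) auto

lemma cyclic_arcs_snoc: "vs \<noteq> [] \<Longrightarrow> cyclic_arcs vs = path_arcs vs @ [(last vs, hd vs)]"
  by (simp add: cyclic_arcs_eq path_arcs_append_single)

text \<open>Ray crossings and orientation products depend only on the multiset of arcs, so this lets
  a cycle start at any of its vertices.\<close>

lemma mset_cyclic_arcs_rotate: "mset (cyclic_arcs (rotate k vs)) = mset (cyclic_arcs vs)"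
proof -
  have "rotate1 (zip xs ys) = zip (rotate1 xs) (rotate1 ys)"
    if "length xs = length ys" for xs ys :: "'a list"
    using that by (cases xs; cases ys) auto
  moreover have "mset (rotate1 xs) = mset xs" for xs :: "('a \<times> 'a) list"
    by (cases xs) auto
  ultimately have "mset (cyclic_arcs (rotate1 us)) = mset (cyclic_arcs us)" for us :: "'a list"
    by (metis length_rotate1)
  then show ?thesis by (induction k) auto
qed

lemma mset_cyclic_arcs_rev:
  assumes "vs \<noteq> []"
  shows "mset (cyclic_arcs (rev vs)) = mset (map prod.swap (cyclic_arcs vs))"
proof -
  have "cyclic_arcs (rev vs) = path_arcs (rev (last vs # vs))"
    using assms by (simp add: cyclic_arcs_eq hd_rev)
  also have "mset \<dots> = mset (map prod.swap (cyclic_arcs vs))"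
    using assms
    by (simp add: path_arcs_rev path_arcs_Cons cyclic_arcs_eq path_arcs_append_single last_rev)
  finally show ?thesis .
qed

lemma fst_set_cyclic_arcs: "fst ` set (cyclic_arcs vs) = set vs"
  by (metis length_rotate1 list.set_map map_fst_zip)

lemma snd_set_cyclic_arcs: "snd ` set (cyclic_arcs vs) = set vs"
  by (metis length_rotate1 list.set_map map_snd_zip set_rotate1)

text \<open>Summing \<open>g\<close> over both ends of all arcs counts each list entry twice, and
  modulo 2 an arc contributes exactly when \<open>g\<close> changes along it. A checkerboard
  colouring will give even cycle length; half rows and half planes will give the parity rules for
  rays.\<close>

lemma even_sign_changes_cycle:
  fixes g :: "'a \<Rightarrow> bool"
  shows "even (length (filter (\<lambda>(p, q). g p \<noteq> g q) (cyclic_arcs vs)))"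
proof -
  let ?f = "\<lambda>p. of_bool (g p) :: nat"
  have sums: "sum_list (map (\<lambda>(p, q). ?f p + ?f q) zs)
      = sum_list (map ?f (map fst zs)) + sum_list (map ?f (map snd zs))" for zs
    by (induction zs) auto
  have "sum_list (map (\<lambda>(p, q). ?f p + ?f q) (cyclic_arcs vs))
      = sum_list (map ?f vs) + sum_list (map ?f (rotate1 vs))"
    by (subst sums) simp
  also have "sum_list (map ?f (rotate1 vs)) = sum_list (map ?f vs)"
    by (cases vs) auto
  finally have "even (sum_list (map (\<lambda>(p, q). ?f p + ?f q) (cyclic_arcs vs)))" by simp
  moreover have "even (sum_list (map (\<lambda>(p, q). ?f p + ?f q) zs))
      = even (length (filter (\<lambda>(p, q). g p \<noteq> g q) zs))" for zs
    by (induction zs) auto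
  ultimately show ?thesis by simp
qed

section \<open>Kasteleyn signs and ray crossings in the grid\<close>

definition grid_adj :: "nat \<times> nat \<Rightarrow> nat \<times> nat \<Rightarrow> bool" where
  "grid_adj p q \<longleftrightarrow>
     fst p = fst q \<and> (snd q = Suc (snd p) \<or> snd p = Suc (snd q)) \<or>
     snd p = snd q \<and> (fst q = Suc (fst p) \<or> fst p = Suc (fst q))"

text \<open>Kasteleyn signs: every unit square has an odd number of clockwise edges.\<close>

definition orient :: "nat \<times> nat \<Rightarrow> nat \<times> nat \<Rightarrow> real" where
  "orient p q =
     (if q = (Suc (fst p), snd p) then 1
      else if p = (Suc (fst q), snd q) then - 1
      else if q = (fst p, Suc (snd p)) then (- 1) ^ fst p
      else if p = (fst q, Suc (snd q)) then - ((- 1) ^ fst p)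
      else 0)"

text \<open>The ray runs at height Y + 1/2 and so never meets a vertex; only vertical edges can
  cross it. Integer coordinates allow steps to X - 1 and Y - 1 beyond the border of the natural
  numbers.\<close>

definition crosses :: "int \<Rightarrow> int \<Rightarrow> (nat \<times> nat) \<times> (nat \<times> nat) \<Rightarrow> bool" where
  "crosses X Y = (\<lambda>(p, q). fst p = fst q \<and> int (fst p) \<le> X \<and> int (min (snd p) (snd q)) = Y)"

text \<open>The number of arcs met by the ray from the face with lower left corner \<open>(X, Y)\<close> to the left.\<close>

definition crossings :: "((nat \<times> nat) \<times> (nat \<times> nat)) list \<Rightarrow> int \<Rightarrow> int \<Rightarrow> nat" where
  "crossings A X Y = length (filter (crosses X Y) A)"

abbreviation crossings_at :: "((nat \<times> nat) \<times> (nat \<times> nat)) list \<Rightarrow> nat \<times> nat \<Rightarrow> nat" where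
  "crossings_at A p \<equiv> crossings A (int (fst p)) (int (snd p))"

definition grid_cycle :: "(nat \<times> nat) list \<Rightarrow> bool" where
  "grid_cycle vs \<longleftrightarrow> distinct vs \<and> 2 \<le> length vs \<and> (\<forall>(p, q) \<in> set (cyclic_arcs vs). grid_adj p q)"

lemma grid_adj_cases [consumes 1, case_names right left up down]:
  assumes "grid_adj p q"
  obtains x y where "p = (x, y)" "q = (Suc x, y)"
  | x y where "p = (Suc x, y)" "q = (x, y)"
  | x y where "p = (x, y)" "q = (x, Suc y)"
  | x y where "p = (x, Suc y)" "q = (x, y)"
  using assms unfolding grid_adj_def by (cases p; cases q) force

lemma grid_adj_sym: "grid_adj p q \<longleftrightarrow> grid_adj q p"
  unfolding grid_adj_def by auto

lemma orient_skew: "orient q p = - orient p q"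
  unfolding orient_def by (cases p; cases q) auto

lemma orient_square: "grid_adj p q \<Longrightarrow> orient p q * orient p q = 1"
  unfolding orient_def grid_adj_def
  by (cases p; cases q) (auto simp: power_mult_distrib[symmetric])

lemma orient_eq_0: "\<not> grid_adj p q \<Longrightarrow> orient p q = 0"
  unfolding orient_def grid_adj_def by (cases p; cases q) auto

lemma crossings_append [simp]: "crossings (A @ B) X Y = crossings A X Y + crossings B X Y"
  by (simp add: crossings_def)

lemma crossings_Cons [simp]:
  "crossings (e # A) X Y = of_bool (crosses X Y e) + crossings A X Y"
  by (simp add: crossings_def)

lemma crossings_Nil [simp]: "crossings [] X Y = 0"
  by (simp add: crossings_def)

lemma crosses_swap: "crosses X Y (prod.swap e) = crosses X Y e"
  by (auto simp: crosses_def min.commute split: prod.splits)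

lemma crossings_cong_mset: "mset A = mset B \<Longrightarrow> crossings A X Y = crossings B X Y"
  unfolding crossings_def by (metis mset_filter size_mset)

lemma crossings_swap: "crossings (map prod.swap A) X Y = crossings A X Y"
  by (simp add: crossings_def filter_map comp_def crosses_swap)

lemma grid_cycle_even_length: "grid_cycle vs \<Longrightarrow> even (length vs)"
proof -
  assume "grid_cycle vs"
  then have "filter (\<lambda>(p, q). even (fst p + snd p) \<noteq> even (fst q + snd q)) (cyclic_arcs vs)
      = cyclic_arcs vs"
    by (intro filter_True) (fastforce simp: grid_cycle_def grid_adj_def)
  then show ?thesis using even_sign_changes_cycle[of "\<lambda>p. even (fst p + snd p)" vs] by simp
qed

lemma grid_cycle_rotate: "grid_cycle vs \<Longrightarrow> grid_cycle (rotate k vs)"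
  unfolding grid_cycle_def using mset_eq_setD[OF mset_cyclic_arcs_rotate[of k vs]] by simp

lemma grid_cycle_rev: "grid_cycle vs \<Longrightarrow> grid_cycle (rev vs)"
proof -
  assume vs: "grid_cycle vs"
  then have "vs \<noteq> []" unfolding grid_cycle_def by auto
  then have "set (cyclic_arcs (rev vs)) = prod.swap ` set (cyclic_arcs vs)"
    using mset_eq_setD[OF mset_cyclic_arcs_rev[of vs]] by simp
  with vs show ?thesis unfolding grid_cycle_def
    by (auto simp: grid_adj_sym)
qed

text \<open>A cycle crosses the boundary of the half row of points at height Y up to column X an
  even number of times. It can leave upwards (met by the ray above the row), downwards (met by the
  ray below), or along the edge to column X + 1, which \<open>no\<close> excludes.\<close>

lemma crossings_vertical_step:
  assumes "\<forall>(p, q) \<in> set (cyclic_arcs vs). grid_adj p q"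
    and no: "\<forall>(p, q) \<in> set (cyclic_arcs vs).
          \<not> (snd p = snd q \<and> int (snd p) = Y \<and> int (min (fst p) (fst q)) = X)"
  shows "odd (crossings (cyclic_arcs vs) X Y) = odd (crossings (cyclic_arcs vs) X (Y - 1))"
proof -
  let ?g = "\<lambda>p :: nat \<times> nat. int (snd p) = Y \<and> int (fst p) \<le> X"
  have *: "of_bool (?g p \<noteq> ?g q) = (of_bool (crosses X Y (p, q)) + of_bool (crosses X (Y - 1) (p, q)) :: nat)"
    if "(p, q) \<in> set (cyclic_arcs vs)" for p q
  proof -
    have "grid_adj p q" using that assms(1) by blast
    moreover have no_pq: "\<not> (snd p = snd q \<and> int (snd p) = Y \<and> int (min (fst p) (fst q)) = X)"
      using that no by blast
    ultimately show ?thesis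
    proof (cases rule: grid_adj_cases)
      case (right x y)
      with no_pq show ?thesis by (auto simp: crosses_def)
    next
      case (left x y)
      with no_pq show ?thesis by (auto simp: crosses_def)
    qed (auto simp: crosses_def)
  qed
  have "length (filter (\<lambda>(p, q). ?g p \<noteq> ?g q) zs) = crossings zs X Y + crossings zs X (Y - 1)"
    if "set zs \<subseteq> set (cyclic_arcs vs)" for zs
    using that
  proof (induction zs)
    case (Cons a zs)
    then have "length (filter (\<lambda>(p, q). ?g p \<noteq> ?g q) (a # zs))
        = of_bool (case a of (p, q) \<Rightarrow> ?g p \<noteq> ?g q) + (crossings zs X Y + crossings zs X (Y - 1))"
      by auto
    also have "of_bool (case a of (p, q) \<Rightarrow> ?g p \<noteq> ?g q)
        = (of_bool (crosses X Y a) + of_bool (crosses X (Y - 1) a) :: nat)"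
      using *[of "fst a" "snd a"] Cons.prems by (auto simp: split_beta)
    finally show ?case by simp
  qed simp
  from this[OF subset_refl] even_sign_changes_cycle[of ?g vs] show ?thesis by simp
qed

lemma crossings_horizontal_step:
  assumes "\<forall>(p, q) \<in> set A.
      \<not> (fst p = fst q \<and> int (fst p) = X \<and> int (min (snd p) (snd q)) = Y)"
  shows "crossings A X Y = crossings A (X - 1) Y"
proof -
  have "filter (crosses X Y) A = filter (crosses (X - 1) Y) A"
  proof (intro filter_cong refl)
    fix e assume "e \<in> set A"
    with assms show "crosses X Y e = crosses (X - 1) Y e"
      by (cases e) (auto simp: crosses_def)
  qed
  then show ?thesis by (simp add: crossings_def)
qed

lemma cyclic_arcs_ends:
  assumes "(p, q) \<in> set (cyclic_arcs vs)"
  shows "p \<in> set vs" "q \<in> set vs"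
  using assms fst_set_cyclic_arcs[of vs] snd_set_cyclic_arcs[of vs] by force+

text \<open>The faces with lower left corners (x, y) and (x, Suc y) share the edge running right
  from (x, Suc y), which a cycle missing that vertex cannot use.\<close>

lemma crossings_up:
  assumes "\<forall>(p, q) \<in> set (cyclic_arcs vs). grid_adj p q" "(x, Suc y) \<notin> set vs"
  shows "odd (crossings_at (cyclic_arcs vs) (x, Suc y)) = odd (crossings_at (cyclic_arcs vs) (x, y))"
proof -
  have "\<not> (snd p = snd q \<and> int (snd p) = int (Suc y) \<and> int (min (fst p) (fst q)) = int x)"
    if pq: "(p, q) \<in> set (cyclic_arcs vs)" for p q
  proof
    assume "snd p = snd q \<and> int (snd p) = int (Suc y) \<and> int (min (fst p) (fst q)) = int x"
    then have "p = (x, Suc y) \<or> q = (x, Suc y)"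
      by (cases p; cases q) (auto simp: min_def split: if_splits)
    with cyclic_arcs_ends[OF pq] assms(2) show False by auto
  qed
  then have "odd (crossings (cyclic_arcs vs) (int x) (int (Suc y)))
      = odd (crossings (cyclic_arcs vs) (int x) (int (Suc y) - 1))"
    by (intro crossings_vertical_step[OF assms(1)]) blast
  then show ?thesis by simp
qed

lemma crossings_right:
  assumes "\<forall>(p, q) \<in> set (cyclic_arcs vs). grid_adj p q"
    and "(Suc x, y) \<notin> set vs \<or> (Suc x, Suc y) \<notin> set vs"
  shows "crossings_at (cyclic_arcs vs) (Suc x, y) = crossings_at (cyclic_arcs vs) (x, y)"
proof -
  have "\<not> (fst p = fst q \<and> int (fst p) = int (Suc x) \<and> int (min (snd p) (snd q)) = int y)"
    if pq: "(p, q) \<in> set (cyclic_arcs vs)" for p q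
  proof
    assume *: "fst p = fst q \<and> int (fst p) = int (Suc x) \<and> int (min (snd p) (snd q)) = int y"
    have "grid_adj p q" using pq assms(1) by blast
    from this * have "{p, q} = {(Suc x, y), (Suc x, Suc y)}"
      by (cases rule: grid_adj_cases) auto
    with cyclic_arcs_ends[OF pq] assms(2) show False by (auto simp: doubleton_eq_iff)
  qed
  then have "crossings (cyclic_arcs vs) (int (Suc x)) (int y)
      = crossings (cyclic_arcs vs) (int (Suc x) - 1) (int y)"
    by (intro crossings_horizontal_step) blast
  then show ?thesis by simp
qed

lemma crossings_adjacent:
  assumes "\<forall>(p, q) \<in> set (cyclic_arcs vs). grid_adj p q"
    and "grid_adj r s" "r \<notin> set vs" "s \<notin> set vs"
  shows "odd (crossings_at (cyclic_arcs vs) r) = odd (crossings_at (cyclic_arcs vs) s)"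
  using assms(2-4) crossings_up[OF assms(1)] crossings_right[OF assms(1)]
  by (cases rule: grid_adj_cases) auto

text \<open>For cutting a cycle in two: away from the cut, the vertices of one piece form a path
  that avoids the other piece, so they all lie on one side of it.\<close>

lemma crossings_path_constant:
  assumes adj: "\<forall>(p, q) \<in> set (cyclic_arcs vs). grid_adj p q"
    and "\<forall>(p, q) \<in> set (path_arcs ps). grid_adj p q" "set ps \<inter> set vs = {}"
    and "p \<in> set ps" "q \<in> set ps"
  shows "odd (crossings_at (cyclic_arcs vs) p) = odd (crossings_at (cyclic_arcs vs) q)"
proof -
  have "\<forall>p \<in> set ps. odd (crossings_at (cyclic_arcs vs) p) = odd (crossings_at (cyclic_arcs vs) (hd ps))"
    using assms(2,3)
  proof (induction ps rule: path_arcs.induct)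
    case (1 x y r)
    then have "odd (crossings_at (cyclic_arcs vs) x) = odd (crossings_at (cyclic_arcs vs) y)"
      by (intro crossings_adjacent[OF adj]) auto
    with 1 show ?case by auto
  qed auto
  then show ?thesis using assms(4,5) by blast
qed

section \<open>The orientation product of a cycle\<close>

abbreviation orient_prod :: "((nat \<times> nat) \<times> (nat \<times> nat)) list \<Rightarrow> real" where
  "orient_prod A \<equiv> prod_list (map (\<lambda>(p, q). orient p q) A)"

definition odd_vertices :: "(nat \<times> nat) set \<Rightarrow> (nat \<times> nat) list \<Rightarrow> (nat \<times> nat) set" where
  "odd_vertices G vs = {p \<in> G - set vs. odd (crossings_at (cyclic_arcs vs) p)}"

lemma orient_prod_cong_mset: "mset A = mset B \<Longrightarrow> orient_prod A = orient_prod B"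
  by (metis mset_map prod_mset_prod_list)

lemma orient_prod_swap: "orient_prod (map prod.swap A) = (- 1) ^ length A * orient_prod A"
proof (induction A)
  case (Cons e A)
  obtain p q where "e = (p, q)" by (cases e)
  then show ?case using Cons orient_skew[of q p] by simp
qed simp

text \<open>With all arcs starting in column x or further right, the ray could only meet the edge
  going up from (x, y) itself.\<close>

lemma crossings_left_end:
  assumes "\<And>p q. (p, q) \<in> set A \<Longrightarrow> x \<le> fst p \<and> p \<noteq> (x, y) \<and> q \<noteq> (x, y)"
  shows "crossings_at A (x, y) = 0"
proof -
  have "\<not> crosses (int x) (int y) e" if "e \<in> set A" for e
    using assms[of "fst e" "snd e"] that
    by (cases e; cases "fst e"; cases "snd e") (auto simp: crosses_def min_def split: if_splits)
  then show ?thesis by (simp add: crossings_def filter_empty_conv)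
qed

text \<open>The left and lower neighbours of the lexicographically least vertex are smaller still,
  so its two distinct neighbours on the cycle are the right and the upper one. Rotation and, if
  necessary, reversal bring the cycle into the stated form.\<close>

lemma grid_cycle_corner:
  assumes "grid_cycle vs" "2 < length vs"
  obtains i j r vs' where "vs' = (i, j) # (Suc i, j) # r @ [(i, Suc j)]"
    "grid_cycle vs'" "set vs' = set vs"
    "mset (cyclic_arcs vs') = mset (cyclic_arcs vs)
      \<or> mset (cyclic_arcs vs') = mset (map prod.swap (cyclic_arcs vs))"
    "\<forall>p \<in> set vs. i < fst p \<or> i = fst p \<and> j \<le> snd p"
proof -
  have ne: "set vs \<noteq> {}" using assms(2) by auto
  define i where "i = Min (fst ` set vs)"
  define j where "j = Min {y. (i, y) \<in> set vs}"
  have "i \<in> fst ` set vs" unfolding i_def using ne by (intro Min_in) auto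
  then have ine: "{y. (i, y) \<in> set vs} \<noteq> {}" by auto
  have fin: "finite {y. (i, y) \<in> set vs}"
    by (rule finite_subset[of _ "snd ` set vs"]) force+
  have vin: "(i, j) \<in> set vs" using Min_in[OF fin ine] unfolding j_def by simp
  have lex: "\<forall>p \<in> set vs. i < fst p \<or> i = fst p \<and> j \<le> snd p"
  proof
    fix p assume p: "p \<in> set vs"
    then have "i \<le> fst p" unfolding i_def by auto
    moreover have "j \<le> snd p" if "i = fst p"
      unfolding j_def using p fin that by (intro Min_le) auto
    ultimately show "i < fst p \<or> i = fst p \<and> j \<le> snd p" by linarith
  qed
  obtain k where k: "k < length vs" "vs ! k = (i, j)" using vin by (metis in_set_conv_nth)
  define us where "us = rotate k vs"
  have us: "grid_cycle us" "set us = set vs" "length us = length vs"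
    "mset (cyclic_arcs us) = mset (cyclic_arcs vs)"
    unfolding us_def using grid_cycle_rotate[OF assms(1)] mset_cyclic_arcs_rotate by auto
  have "hd us = (i, j)" unfolding us_def using k hd_rotate_conv_nth[of vs k] by (cases vs) auto
  then obtain t where t: "us = (i, j) # t" using us(3) assms(2) by (cases us) auto
  then obtain u s where u: "t = u # s" using us(3) assms(2) by (cases t) auto
  then obtain r u' where r: "s = r @ [u']" using us(3) assms(2) t
    by (cases s rule: rev_cases) auto
  have dist: "u \<noteq> u'" using us(1) unfolding grid_cycle_def t u r by auto
  have "cyclic_arcs us = ((i, j), u) # path_arcs t @ [(u', (i, j))]"
    unfolding t u r by (subst cyclic_arcs_Cons) auto
  then have adj: "grid_adj (i, j) u" "grid_adj u' (i, j)"
    using us(1) unfolding grid_cycle_def by auto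
  have lu: "i < fst u \<or> i = fst u \<and> j \<le> snd u" "i < fst u' \<or> i = fst u' \<and> j \<le> snd u'"
    using lex us(2) unfolding t u r by auto
  have u1: "u = (Suc i, j) \<or> u = (i, Suc j)"
    using adj(1) lu(1) by (cases rule: grid_adj_cases) auto
  have u2: "u' = (Suc i, j) \<or> u' = (i, Suc j)"
    using adj(2) lu(2) by (cases rule: grid_adj_cases) auto
  from u1 show thesis
  proof
    assume "u = (Suc i, j)"
    with dist u2 have "us = (i, j) # (Suc i, j) # r @ [(i, Suc j)]" unfolding t u r by auto
    then show thesis using that us lex by blast
  next
    \<comment> \<open>Here the cycle leaves the corner upwards; it is reversed, and the corner, now
      last, is rotated back to the front.\<close>
    assume 1: "u = (i, Suc j)"
    define us' where "us' = rotate (length (rev t)) (rev us)"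
    have "us' = (i, j) # rev t" unfolding us'_def t rev.simps rotate_append by simp
    then have "us' = (i, j) # (Suc i, j) # rev r @ [(i, Suc j)]"
      using 1 dist u2 unfolding t u r by auto
    moreover have "grid_cycle us'" "set us' = set vs"
      unfolding us'_def using grid_cycle_rotate[OF grid_cycle_rev[OF us(1)]] us(2) by auto
    moreover have "mset (cyclic_arcs us') = mset (map prod.swap (cyclic_arcs vs))"
    proof -
      have "mset (cyclic_arcs us') = mset (map prod.swap (cyclic_arcs us))"
        unfolding us'_def using t
        by (subst mset_cyclic_arcs_rotate, subst mset_cyclic_arcs_rev) auto
      also have "\<dots> = mset (map prod.swap (cyclic_arcs vs))"
        using us(4) by (metis mset_map)
      finally show ?thesis .
    qed
    ultimately show thesis using that lex by blast
  qed
qed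

lemma sign_card_xor:
  assumes "finite D"
  shows "(- 1 :: real) ^ card {p \<in> D. P p \<noteq> Q p}
    = (- 1) ^ card {p \<in> D. P p} * (- 1) ^ card {p \<in> D. Q p}"
proof -
  have sgn: "(- 1 :: real) ^ card {p \<in> D. R p} = (\<Prod>p\<in>D. if R p then - 1 else 1)" for R
    using assms by (simp add: prod.If_cases Int_def)
  show ?thesis unfolding sgn prod.distrib[symmetric] by (intro prod.cong) auto
qed

lemma orient_corner:
  "orient (i, j) (Suc i, j) = 1" "orient (i, Suc j) (i, j) = - ((- 1) ^ i)"
  "orient (Suc i, Suc j) (Suc i, j) = (- 1) ^ i" "orient (i, Suc j) (Suc i, Suc j) = 1"
  by (auto simp: orient_def)

text \<open>The cycles through (i, j) and through the opposite corner differ by one unit square, and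
  their crossing counts differ only at the face of that square. So the larger cycle gains exactly
  the opposite corner as an odd vertex, while (i, j) is even for the smaller one. The matching
  factor -1 is the Kasteleyn property of the square.\<close>

lemma orient_prod_flip_corner:
  assumes t: "t = (Suc i, j) # r @ [(i, Suc j)]"
    and cyc: "grid_cycle ((i, j) # t)"
    and lex: "\<forall>p \<in> set t. i < fst p \<or> i = fst p \<and> j \<le> snd p"
    and w: "(Suc i, Suc j) \<notin> set t" "(Suc i, Suc j) \<in> G" and "finite G" "(i, j) \<in> G"
    and IH: "grid_cycle ((Suc i, Suc j) # t) \<Longrightarrow> orient_prod (cyclic_arcs ((Suc i, Suc j) # t))
      = - ((- 1) ^ card (odd_vertices G ((Suc i, Suc j) # t)))"
  shows "orient_prod (cyclic_arcs ((i, j) # t)) = - ((- 1) ^ card (odd_vertices G ((i, j) # t)))"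
proof -
  let ?v = "(i, j)" and ?w = "(Suc i, Suc j)"
  define R where "R = path_arcs t"
  have A: "cyclic_arcs (x # t) = (x, (Suc i, j)) # R @ [((i, Suc j), x)]" for x
    unfolding R_def t by (subst cyclic_arcs_Cons) auto
  have vt: "?v \<notin> set t" "distinct t" using cyc unfolding grid_cycle_def by auto
  have Radj: "\<forall>(p, q) \<in> set R. grid_adj p q"
    using cyc unfolding grid_cycle_def A by auto
  have cw: "grid_cycle (?w # t)"
    using w(1) vt Radj unfolding grid_cycle_def A by (auto simp: t grid_adj_def)
  have Rends: "p \<in> set t \<and> q \<in> set t" if "(p, q) \<in> set R" for p q
    using that unfolding R_def by (induction t rule: path_arcs.induct) auto
  have R0: "crossings_at R (i, j) = 0"
    using Rends lex vt(1) by (intro crossings_left_end) (metis order.order_iff_strict)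
  have same: "crossings_at (cyclic_arcs (?v # t)) p = crossings_at (cyclic_arcs (?w # t)) p"
    if "p \<noteq> ?v" for p
    using that unfolding A by (cases p) (auto simp: crosses_def)
  have v: "crossings_at (cyclic_arcs (?v # t)) ?v = 1" "crossings_at (cyclic_arcs (?w # t)) ?v = 0"
    using R0 unfolding A by (auto simp: crosses_def)
  have adj: "\<forall>(p, q) \<in> set (cyclic_arcs (?v # t)). grid_adj p q"
    using cyc unfolding grid_cycle_def by blast
  have "odd (crossings_at (cyclic_arcs (?v # t)) ?w)"
    using crossings_up[OF adj, of "Suc i" j] crossings_right[OF adj, of i j] w(1) v(1) by auto
  then have "odd_vertices G (?v # t) = insert ?w (odd_vertices G (?w # t))"
  proof -
    define c where "c x p = odd (crossings_at (cyclic_arcs (x # t)) p)" for x p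
    have "c ?v p = c ?w p" if "p \<noteq> ?v" for p using same[OF that] unfolding c_def by simp
    moreover have "c ?v ?w" "\<not> c ?w ?v"
      using \<open>odd (crossings_at (cyclic_arcs (?v # t)) ?w)\<close> v(2) unfolding c_def by auto
    ultimately show ?thesis
      unfolding odd_vertices_def c_def[symmetric] using w vt(1)
      by (intro Set.set_eqI, rename_tac p, case_tac "p = ?v"; case_tac "p = ?w") auto
  qed
  moreover have "?w \<notin> odd_vertices G (?w # t)" "finite (odd_vertices G (?w # t))"
    unfolding odd_vertices_def using \<open>finite G\<close> by auto
  ultimately have "card (odd_vertices G (?v # t)) = Suc (card (odd_vertices G (?w # t)))" by simp
  moreover have "orient_prod (cyclic_arcs (?v # t)) = - orient_prod (cyclic_arcs (?w # t))"
    unfolding A by (simp add: orient_corner)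
  ultimately show "orient_prod (cyclic_arcs (?v # t)) = - ((- 1) ^ card (odd_vertices G (?v # t)))"
    using IH[OF cw] by simp
qed

text \<open>The opposite corner w already lies on the cycle, so removing the unit square leaves two
  cycles meeting only in w. Modulo 2 the enclosed vertices of the whole are those of the two parts,
  and the four edges of the square supply the sign that turns two factors -1 into one.\<close>

lemma orient_prod_split_corner:
  fixes xs ys :: "(nat \<times> nat) list" and i j :: nat
  defines "l1 \<equiv> (Suc i, j) # xs @ [(Suc i, Suc j)]" and "l2 \<equiv> (Suc i, Suc j) # ys @ [(i, Suc j)]"
    and "vs \<equiv> (i, j) # (Suc i, j) # xs @ (Suc i, Suc j) # ys @ [(i, Suc j)]"
  assumes cyc: "grid_cycle vs"
    and lex: "\<forall>p \<in> set vs. i < fst p \<or> i = fst p \<and> j \<le> snd p"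
    and G: "finite G" "set vs \<subseteq> G"
    and IH1: "grid_cycle l1 \<Longrightarrow> orient_prod (cyclic_arcs l1) = - ((- 1) ^ card (odd_vertices G l1))"
    and IH2: "grid_cycle l2 \<Longrightarrow> orient_prod (cyclic_arcs l2) = - ((- 1) ^ card (odd_vertices G l2))"
  shows "orient_prod (cyclic_arcs vs) = - ((- 1) ^ card (odd_vertices G vs))"
proof -
  let ?v = "(i, j)" and ?u = "(Suc i, j)" and ?w = "(Suc i, Suc j)" and ?u' = "(i, Suc j)"
  define R1 where "R1 = path_arcs l1"
  define R2 where "R2 = path_arcs l2"
  have "path_arcs (?u # xs @ ?w # ys @ [?u']) = R1 @ R2"
    unfolding R1_def R2_def l1_def l2_def
    using path_arcs_append[of "?u # xs" ?w "ys @ [?u']"] by simp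
  then have A: "cyclic_arcs vs = (?v, ?u) # R1 @ R2 @ [(?u', ?v)]"
    unfolding vs_def by (subst cyclic_arcs_Cons) auto
  have A1: "cyclic_arcs l1 = R1 @ [(?w, ?u)]"
    unfolding R1_def by (subst cyclic_arcs_snoc) (auto simp: l1_def)
  have A2: "cyclic_arcs l2 = R2 @ [(?u', ?w)]"
    unfolding R2_def by (subst cyclic_arcs_snoc) (auto simp: l2_def)
  have d: "distinct vs" and adj: "\<forall>(p, q) \<in> set (cyclic_arcs vs). grid_adj p q"
    using cyc unfolding grid_cycle_def by auto
  have adj1: "\<forall>(p, q) \<in> set (cyclic_arcs l1). grid_adj p q"
    and adj2: "\<forall>(p, q) \<in> set (cyclic_arcs l2). grid_adj p q"
    using adj unfolding A A1 A2 by (auto simp: grid_adj_def)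
  have cyc1: "grid_cycle l1" and cyc2: "grid_cycle l2"
    using d adj1 adj2 unfolding grid_cycle_def by (auto simp: l1_def l2_def vs_def)
  have sets: "set vs = insert ?v (set l1 \<union> set l2)" "set l1 \<inter> set l2 = {?w}"
    "?v \<notin> set l1" "?v \<notin> set l2"
    using d by (auto simp: l1_def l2_def vs_def)
  have v1: "crossings_at (cyclic_arcs l1) ?v = 0" and v2: "crossings_at (cyclic_arcs l2) ?v = 0"
  proof -
    have "crossings_at (cyclic_arcs l) ?v = 0" if l: "set l \<subseteq> set vs" "?v \<notin> set l" for l
    proof (rule crossings_left_end)
      fix p q assume "(p, q) \<in> set (cyclic_arcs l)"
      from cyclic_arcs_ends[OF this] l lex show "i \<le> fst p \<and> p \<noteq> ?v \<and> q \<noteq> ?v"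
        by (metis less_imp_le order_refl subsetD)
    qed
    with sets show "crossings_at (cyclic_arcs l1) ?v = 0" "crossings_at (cyclic_arcs l2) ?v = 0"
      by auto
  qed
  \<comment> \<open>The corner (i, j) has no crossings with either part; its neighbour on the other
    part is off this one, so it inherits even parity, which then spreads along its own part up to
    w.\<close>
  have u'1: "even (crossings_at (cyclic_arcs l1) ?u')"
    using crossings_adjacent[OF adj1, of ?v ?u'] v1 sets d
    by (auto simp: grid_adj_def l1_def vs_def)
  have u2: "even (crossings_at (cyclic_arcs l2) ?u)"
    using crossings_adjacent[OF adj2, of ?v ?u] v2 sets d
    by (auto simp: grid_adj_def l2_def vs_def)
  have e1: "even (crossings_at (cyclic_arcs l1) p)" if "p \<in> set l2 - {?w}" for p
  proof -
    have "\<forall>(p, q) \<in> set (path_arcs (ys @ [?u'])). grid_adj p q"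
    proof -
      have "path_arcs l2 = (?w, hd (ys @ [?u'])) # path_arcs (ys @ [?u'])"
        unfolding l2_def by (rule path_arcs_Cons) simp
      then show ?thesis using adj2 unfolding A2 R2_def by auto
    qed
    moreover have "set (ys @ [?u']) \<inter> set l1 = {}"
      using d by (auto simp: l1_def vs_def)
    ultimately show ?thesis
      using crossings_path_constant[OF adj1, of "ys @ [?u']" p ?u'] u'1 that
      by (auto simp: l2_def)
  qed
  have e2: "even (crossings_at (cyclic_arcs l2) p)" if "p \<in> set l1 - {?w}" for p
  proof -
    have "\<forall>(p, q) \<in> set (path_arcs (?u # xs)). grid_adj p q"
    proof -
      have "path_arcs l1 = path_arcs (?u # xs) @ [(last (?u # xs), ?w)]"
        unfolding l1_def using path_arcs_append_single[of "?u # xs" ?w] by simp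
      then show ?thesis using adj1 unfolding A1 R1_def by auto
    qed
    moreover have "set (?u # xs) \<inter> set l2 = {}"
      using d by (auto simp: l2_def vs_def)
    ultimately show ?thesis
      using crossings_path_constant[OF adj2, of "?u # xs" p ?u] u2 that
      by (auto simp: l1_def)
  qed
  have o1: "odd_vertices G l1 = {p \<in> G - set vs. odd (crossings_at (cyclic_arcs l1) p)}"
    unfolding odd_vertices_def using e1 v1 sets by auto
  have o2: "odd_vertices G l2 = {p \<in> G - set vs. odd (crossings_at (cyclic_arcs l2) p)}"
    unfolding odd_vertices_def using e2 v2 sets by auto
  \<comment> \<open>The original cycle uses the vertical side of the square in column i, the first
    part the side in column i + 1. Only the ray from the face between them distinguishes the
    two.\<close>
  have par: "odd (crossings_at (cyclic_arcs vs) p)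
      = (odd (crossings_at (cyclic_arcs l1) p) \<noteq> odd (crossings_at (cyclic_arcs l2) p))"
    if "p \<noteq> ?v" for p
    using that unfolding A A1 A2 by (cases p) (auto simp: crosses_def)
  have "(- 1 :: real) ^ card (odd_vertices G vs)
      = (- 1) ^ card (odd_vertices G l1) * (- 1) ^ card (odd_vertices G l2)"
  proof -
    have "odd_vertices G vs = {p \<in> G - set vs.
        odd (crossings_at (cyclic_arcs l1) p) \<noteq> odd (crossings_at (cyclic_arcs l2) p)}"
      unfolding odd_vertices_def
    proof (intro Collect_cong conj_cong refl)
      fix p assume "p \<in> G - set vs"
      then have "p \<noteq> ?v" using sets(1) by auto
      from par[OF this] show "odd (crossings_at (cyclic_arcs vs) p)
        = (odd (crossings_at (cyclic_arcs l1) p) \<noteq> odd (crossings_at (cyclic_arcs l2) p))" .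
    qed
    then show ?thesis unfolding o1 o2 using G(1) by (simp only: sign_card_xor finite_Diff)
  qed
  moreover have "orient_prod (cyclic_arcs vs)
      = - (orient_prod (cyclic_arcs l1) * orient_prod (cyclic_arcs l2))"
    unfolding A A1 A2 by (simp add: orient_corner)
  ultimately show "orient_prod (cyclic_arcs vs) = - ((- 1) ^ card (odd_vertices G vs))"
    using IH1[OF cyc1] IH2[OF cyc2] by simp
qed

text \<open>Replacing the lexicographically least vertex of a cycle by the opposite corner of its unit
  square, or cutting the cycle there when that corner already lies on it, reduces every cycle to
  doubled edges.\<close>

theorem orient_prod_grid_cycle:
  fixes m n :: nat
  defines "G \<equiv> {1..m} \<times> {1..n}"
  assumes "grid_cycle vs" "set vs \<subseteq> G"
  shows "orient_prod (cyclic_arcs vs) = - ((- 1) ^ card (odd_vertices G vs))"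
  using assms(2,3)
\<comment> \<open>Inside G every summand is at least 1, so dropping a vertex lowers the sum, and so
  does moving one to the opposite corner, which is further from the origin. Enclosed area would not
  serve before an interior is available.\<close>
proof (induction "\<Sum>p\<in>set vs. m + n + 1 - (fst p + snd p)" arbitrary: vs rule: less_induct)
  case less
  let ?h = "\<lambda>p. m + n + 1 - (fst p + snd p)"
  have fG: "finite G" unfolding G_def by simp
  show ?case
  proof (cases "length vs = 2")
    case True
    then obtain a b where vs: "vs = [a, b]"
      by (auto simp: numeral_2_eq_2 length_Suc_conv)
    have "grid_adj a b" using less.prems(1) unfolding vs grid_cycle_def by auto
    then have "orient_prod (cyclic_arcs vs) = - 1"
      using orient_square[of a b] orient_skew[of b a] unfolding vs by simp
    moreover have "even (crossings (cyclic_arcs vs) X Y)" for X Y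
      using crosses_swap[of X Y "(a, b)"] unfolding vs by simp
    ultimately show ?thesis unfolding odd_vertices_def by simp
  next
    case False
    then have "2 < length vs" using less.prems(1) unfolding grid_cycle_def by auto
    then obtain i j r us where us: "us = (i, j) # (Suc i, j) # r @ [(i, Suc j)]"
      "grid_cycle us" "set us = set vs" and
      ms: "mset (cyclic_arcs us) = mset (cyclic_arcs vs)
        \<or> mset (cyclic_arcs us) = mset (map prod.swap (cyclic_arcs vs))" and
      lex: "\<forall>p \<in> set vs. i < fst p \<or> i = fst p \<and> j \<le> snd p"
      using grid_cycle_corner[OF less.prems(1)] by metis
    define t where "t = (Suc i, j) # r @ [(i, Suc j)]"
    have ust: "us = (i, j) # t" unfolding us(1) t_def by simp
    have inG: "(i, j) \<in> G" "(Suc i, Suc j) \<in> G" "set t \<subseteq> G"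
    proof -
      have G: "set us \<subseteq> G" using less.prems(2) us(3) by simp
      then show "(i, j) \<in> G" "set t \<subseteq> G" unfolding ust by auto
      have "(Suc i, j) \<in> G" "(i, Suc j) \<in> G" using G unfolding us(1) by auto
      then show "(Suc i, Suc j) \<in> G" unfolding G_def by simp
    qed
    have d: "(i, j) \<notin> set t" using us(2) unfolding ust grid_cycle_def by auto
    have "orient_prod (cyclic_arcs us) = - ((- 1) ^ card (odd_vertices G us))"
    proof (cases "(Suc i, Suc j) \<in> set t")
      case False
      let ?t = "(Suc i, Suc j) # t"
      have "(\<Sum>p\<in>set ?t. ?h p) < (\<Sum>p\<in>set vs. ?h p)"
        unfolding us(3)[symmetric] ust using False d inG(2) by (auto simp: G_def)
      moreover have "set ?t \<subseteq> G" using inG by simp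
      ultimately have "grid_cycle ?t \<Longrightarrow>
          orient_prod (cyclic_arcs ?t) = - ((- 1) ^ card (odd_vertices G ?t))"
        using less.hyps[of ?t] by blast
      then show ?thesis
        using orient_prod_flip_corner[OF t_def us(2)[unfolded ust] _ False inG(2) fG inG(1)] lex
        unfolding ust us(3)[symmetric] by simp
    next
      case True
      then have "(Suc i, Suc j) \<in> set r" unfolding t_def by auto
      then obtain xs ys where r: "r = xs @ (Suc i, Suc j) # ys" by (meson split_list)
      have us': "us = (i, j) # (Suc i, j) # xs @ (Suc i, Suc j) # ys @ [(i, Suc j)]"
        unfolding us(1) r by simp
      let ?l1 = "(Suc i, j) # xs @ [(Suc i, Suc j)]" and ?l2 = "(Suc i, Suc j) # ys @ [(i, Suc j)]"
      have IH: "orient_prod (cyclic_arcs l) = - ((- 1) ^ card (odd_vertices G l))"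
        if "set l \<subseteq> set t" "grid_cycle l" for l
      proof -
        have "(\<Sum>p\<in>set l. ?h p) \<le> (\<Sum>p\<in>set t. ?h p)"
          using that by (intro sum_mono2) auto
        also have "\<dots> < (\<Sum>p\<in>set us. ?h p)"
          unfolding ust using d inG(1) by (auto simp: G_def)
        finally show ?thesis using that inG(3) less.hyps[of l] us(3) by auto
      qed
      have sub: "set ?l1 \<subseteq> set t" "set ?l2 \<subseteq> set t" unfolding t_def r by auto
      show ?thesis
        unfolding us' using lex us(2,3) less.prems(2) us'
        by (intro orient_prod_split_corner[OF _ _ fG _ IH[OF sub(1)] IH[OF sub(2)]]) auto
    qed
    moreover have "odd_vertices G us = odd_vertices G vs"
      "orient_prod (cyclic_arcs us) = orient_prod (cyclic_arcs vs)"
      using ms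
    proof (atomize (full), elim disjE)
      assume *: "mset (cyclic_arcs us) = mset (cyclic_arcs vs)"
      then show "odd_vertices G us = odd_vertices G vs
          \<and> orient_prod (cyclic_arcs us) = orient_prod (cyclic_arcs vs)"
        using us(3) unfolding odd_vertices_def 
        by (simp only: crossings_cong_mset[OF *] orient_prod_cong_mset[OF *] simp_thms)
    next
      assume *: "mset (cyclic_arcs us) = mset (map prod.swap (cyclic_arcs vs))"
      have "orient_prod (cyclic_arcs us) = orient_prod (cyclic_arcs vs)"
        using orient_prod_cong_mset[OF *] orient_prod_swap[of "cyclic_arcs vs"]
          grid_cycle_even_length[OF less.prems(1)] by simp
      moreover have "crossings (cyclic_arcs us) X Y = crossings (cyclic_arcs vs) X Y" for X Y
        by (simp only: crossings_cong_mset[OF *] crossings_swap)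
      ultimately show "odd_vertices G us = odd_vertices G vs
          \<and> orient_prod (cyclic_arcs us) = orient_prod (cyclic_arcs vs)"
        using us(3) unfolding odd_vertices_def by simp
    qed
    ultimately show ?thesis by simp
  qed
qed

section \<open>Vertices enclosed by a grid cycle\<close>

definition grid_point :: "nat \<times> nat \<Rightarrow> complex" where
  "grid_point p = Complex (real (fst p)) (real (snd p))"

lemma Re_grid_point [simp]: "Re (grid_point p) = real (fst p)"
  and Im_grid_point [simp]: "Im (grid_point p) = real (snd p)"
  by (simp_all add: grid_point_def)

lemma grid_point_eq_iff [simp]: "grid_point p = grid_point q \<longleftrightarrow> p = q"
  by (auto simp: complex_eq_iff prod_eq_iff)

abbreviation grid_segment :: "nat \<times> nat \<Rightarrow> nat \<times> nat \<Rightarrow> complex set" where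
  "grid_segment p q \<equiv> closed_segment (grid_point p) (grid_point q)"

definition cycle_curve :: "(nat \<times> nat) list \<Rightarrow> complex set" where
  "cycle_curve vs = (\<Union>(p, q) \<in> set (cyclic_arcs vs). grid_segment p q)"

lemma grid_segment_cases [consumes 1, case_names horizontal vertical]:
  assumes "grid_adj p q"
  obtains x y where "{p, q} = {(x, y), (Suc x, y)}"
      "grid_segment p q = {z. Im z = real y \<and> real x \<le> Re z \<and> Re z \<le> real x + 1}"
  | x y where "{p, q} = {(x, y), (x, Suc y)}"
      "grid_segment p q = {z. Re z = real x \<and> real y \<le> Im z \<and> Im z \<le> real y + 1}"
  using assms
proof (cases rule: grid_adj_cases)
  case (right x y)
  then show thesis
    by (intro that(1)[of x y]) (auto simp: closed_segment_same_Im closed_segment_eq_real_ivl)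
next
  case (left x y)
  then show thesis
    by (intro that(1)[of x y]) (auto simp: closed_segment_same_Im closed_segment_eq_real_ivl)
next
  case (up x y)
  then show thesis
    by (intro that(2)[of x y]) (auto simp: closed_segment_same_Re closed_segment_eq_real_ivl)
next
  case (down x y)
  then show thesis
    by (intro that(2)[of x y]) (auto simp: closed_segment_same_Re closed_segment_eq_real_ivl)
qed

lemma grid_segments_Int:
  assumes "grid_adj a b" "grid_adj p q" "{a, b} \<noteq> {p, q}"
    and "z \<in> grid_segment a b" "z \<in> grid_segment p q"
  shows "z \<in> grid_point ` ({a, b} \<inter> {p, q})"
  using assms(1)
proof (cases rule: grid_segment_cases)
  case ab: (horizontal x y)
  from assms(2) show ?thesis
  proof (cases rule: grid_segment_cases)
    case pq: (horizontal x' y')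
    have z: "Im z = real y" "Im z = real y'" "real x \<le> Re z" "Re z \<le> real x + 1"
      "real x' \<le> Re z" "Re z \<le> real x' + 1"
      using assms(4,5) unfolding ab(2) pq(2) by auto
    then have "y' = y" by simp
    with assms(3) ab(1) pq(1) have "x \<noteq> x'" by auto
    moreover have "real x' \<le> real (Suc x)" "real x \<le> real (Suc x')" using z by simp_all
    ultimately have "x' = Suc x \<or> x = Suc x'" by linarith
    then show ?thesis
    proof
      assume "x' = Suc x"
      moreover from this z have "z = grid_point (x', y)" by (simp add: complex_eq_iff)
      ultimately show ?thesis unfolding ab(1) pq(1) \<open>y' = y\<close> by auto
    next
      assume "x = Suc x'"
      moreover from this z have "z = grid_point (x, y)" by (simp add: complex_eq_iff)
      ultimately show ?thesis unfolding ab(1) pq(1) \<open>y' = y\<close> by auto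
    qed
  next
    case pq: (vertical x' y')
    have z: "Im z = real y" "Re z = real x'" "real x \<le> Re z" "Re z \<le> real x + 1"
      "real y' \<le> Im z" "Im z \<le> real y' + 1"
      using assms(4,5) unfolding ab(2) pq(2) by auto
    then have "x' = x \<or> x' = Suc x" "y = y' \<or> y = Suc y'" by linarith+
    moreover have "z = grid_point (x', y)" using z by (simp add: complex_eq_iff)
    ultimately show ?thesis unfolding ab(1) pq(1) by auto
  qed
next
  case ab: (vertical x y)
  from assms(2) show ?thesis
  proof (cases rule: grid_segment_cases)
    case pq: (vertical x' y')
    have z: "Re z = real x" "Re z = real x'" "real y \<le> Im z" "Im z \<le> real y + 1"
      "real y' \<le> Im z" "Im z \<le> real y' + 1"
      using assms(4,5) unfolding ab(2) pq(2) by auto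
    then have "x' = x" by simp
    with assms(3) ab(1) pq(1) have "y \<noteq> y'" by auto
    moreover have "real y' \<le> real (Suc y)" "real y \<le> real (Suc y')" using z by simp_all
    ultimately have "y' = Suc y \<or> y = Suc y'" by linarith
    then show ?thesis
    proof
      assume "y' = Suc y"
      moreover from this z have "z = grid_point (x, y')" by (simp add: complex_eq_iff)
      ultimately show ?thesis unfolding ab(1) pq(1) \<open>x' = x\<close> by auto
    next
      assume "y = Suc y'"
      moreover from this z have "z = grid_point (x, y)" by (simp add: complex_eq_iff)
      ultimately show ?thesis unfolding ab(1) pq(1) \<open>x' = x\<close> by auto
    qed
  next
    case pq: (horizontal x' y')
    have z: "Re z = real x" "Im z = real y'" "real y \<le> Im z" "Im z \<le> real y + 1"
      "real x' \<le> Re z" "Re z \<le> real x' + 1"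
      using assms(4,5) unfolding ab(2) pq(2) by auto
    then have "x = x' \<or> x = Suc x'" "y' = y \<or> y' = Suc y" by linarith+
    moreover have "z = grid_point (x, y')" using z by (simp add: complex_eq_iff)
    ultimately show ?thesis unfolding ab(1) pq(1) by auto
  qed
qed

lemma grid_point_in_segment:
  assumes "grid_adj p q" "grid_point r \<in> grid_segment p q"
  shows "r = p \<or> r = q"
  using assms(1)
proof (cases rule: grid_segment_cases)
  case (horizontal x y)
  have "r \<in> {p, q}"
    using assms(2) unfolding horizontal by (cases r) auto
  then show ?thesis by auto
next
  case (vertical x y)
  have "r \<in> {p, q}"
    using assms(2) unfolding vertical by (cases r) auto
  then show ?thesis by auto
qed

text \<open>The last equation is a filler for lists with fewer than two points; the lemmas on
  polygonal paths assume at least two.\<close>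

fun polygonal_path :: "complex list \<Rightarrow> real \<Rightarrow> complex" where
  "polygonal_path (a # b # c # r) = linepath a b +++ polygonal_path (b # c # r)"
| "polygonal_path [a, b] = linepath a b"
| "polygonal_path _ = linepath 0 0"

lemma path_arcs_ends: "(p, q) \<in> set (path_arcs t) \<Longrightarrow> p \<in> set t \<and> q \<in> set t"
  by (induction t rule: path_arcs.induct) auto

lemma arc_grid_path:
  assumes "2 \<le> length t" "distinct t" "\<forall>(p, q) \<in> set (path_arcs t). grid_adj p q"
  defines "g \<equiv> polygonal_path (map grid_point t)"
  shows "arc g \<and> pathstart g = grid_point (hd t) \<and> pathfinish g = grid_point (last t)
    \<and> path_image g = (\<Union>(p, q) \<in> set (path_arcs t). grid_segment p q)"
  using assms(1-3) unfolding g_def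
proof (induction t rule: path_arcs.induct)
  case (1 a b r)
  have "grid_point a \<noteq> grid_point b" using 1(3) by auto
  then have ab: "arc (linepath (grid_point a) (grid_point b))" by (rule arc_linepath)
  show ?case
  proof (cases r)
    case Nil
    then show ?thesis using ab by simp
  next
    case (Cons c s)
    let ?t = "b # c # s"
    let ?h = "polygonal_path (map grid_point ?t)"
    have IH: "arc ?h" "pathstart ?h = grid_point b" "pathfinish ?h = grid_point (last ?t)"
      "path_image ?h = (\<Union>(p, q) \<in> set (path_arcs ?t). grid_segment p q)"
      using 1 Cons by auto
    have "path_image (linepath (grid_point a) (grid_point b)) \<inter> path_image ?h \<subseteq> {grid_point b}"
    proof
      fix z assume "z \<in> path_image (linepath (grid_point a) (grid_point b)) \<inter> path_image ?h"
      then have "z \<in> grid_segment a b" "z \<in> (\<Union>(p, q) \<in> set (path_arcs ?t). grid_segment p q)"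
        unfolding IH(4) by auto
      then obtain p q where pq: "(p, q) \<in> set (path_arcs ?t)" "z \<in> grid_segment p q"
        and z: "z \<in> grid_segment a b"
        by (auto simp del: path_arcs.simps)
      have "a \<noteq> p" "a \<noteq> q" using path_arcs_ends[OF pq(1)] 1(3) Cons by auto
      moreover have "grid_adj a b" "grid_adj p q" using 1(4) pq(1) Cons by auto
      ultimately have "z \<in> grid_point ` ({a, b} \<inter> {p, q})"
        by (intro grid_segments_Int) (use z pq(2) in \<open>auto simp: doubleton_eq_iff\<close>)
      then show "z \<in> {grid_point b}" using \<open>a \<noteq> p\<close> \<open>a \<noteq> q\<close> by auto
    qed
    then have "arc (linepath (grid_point a) (grid_point b) +++ ?h)"
      using ab IH by (intro arc_join) auto
    then show ?thesis
      using IH Cons by (simp add: path_image_join)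
  qed
qed auto

lemma simple_closed_path_cycle:
  assumes "grid_cycle vs" "2 < length vs"
  obtains c where "simple_path c" "pathfinish c = pathstart c" "path_image c = cycle_curve vs"
proof -
  let ?g = "polygonal_path (map grid_point vs)" and ?e = "linepath (grid_point (last vs)) (grid_point (hd vs))"
  have ne: "vs \<noteq> []" using assms(2) by auto
  have A: "cyclic_arcs vs = path_arcs vs @ [(last vs, hd vs)]" by (rule cyclic_arcs_snoc[OF ne])
  have d: "distinct vs" and adj: "\<forall>(p, q) \<in> set (path_arcs vs). grid_adj p q"
    "grid_adj (last vs) (hd vs)"
    using assms(1) unfolding grid_cycle_def A by auto
  have g: "arc ?g" "pathstart ?g = grid_point (hd vs)" "pathfinish ?g = grid_point (last vs)"
    "path_image ?g = (\<Union>(p, q) \<in> set (path_arcs vs). grid_segment p q)"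
    using arc_grid_path[of vs] assms(2) d adj by auto
  obtain a b r where vs: "vs = a # b # r" "r \<noteq> []"
    using assms(2) by (cases vs; cases "tl vs"; cases "tl (tl vs)") auto
  have "path_image ?g \<inter> path_image ?e \<subseteq> {pathstart ?g, pathstart ?e}"
  proof
    fix z assume "z \<in> path_image ?g \<inter> path_image ?e"
    then obtain p q where pq: "(p, q) \<in> set (path_arcs vs)" "z \<in> grid_segment p q"
      and z: "z \<in> grid_segment (last vs) (hd vs)"
      unfolding g(4) by auto
    \<comment> \<open>The closing edge must not repeat an edge of the path. No path arc starts at
      the last vertex, and one from the first vertex to the last would make the last vertex the
      second, against length above 2.\<close>
    have "fst ` set (path_arcs t) \<subseteq> set (butlast t)" for t :: "(nat \<times> nat) list"
      by (induction t rule: path_arcs.induct) auto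
    then have "p \<in> set (butlast vs)" using pq(1) by force
    then have "p \<noteq> last vs"
      using d ne by (metis append_butlast_last_id distinct_butlast not_distinct_conv_prefix)
    moreover have "p \<noteq> a" if "q = last vs"
    proof
      assume "p = a"
      then have "q = b" using pq(1) path_arcs_ends[of p q "b # r"] d unfolding vs(1) by auto
      then show False using that d vs by auto
    qed
    ultimately have "{last vs, hd vs} \<noteq> {p, q}" using vs by (auto simp: doubleton_eq_iff)
    then have "z \<in> grid_point ` ({last vs, hd vs} \<inter> {p, q})"
      using pq adj z by (intro grid_segments_Int) auto
    then show "z \<in> {pathstart ?g, pathstart ?e}" using g by auto
  qed
  moreover have "arc ?e"
    using d vs by (intro arc_linepath) auto
  ultimately have "simple_path (?g +++ ?e)"
    using g by (intro simple_path_join_loop) auto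
  moreover have "path_image (?g +++ ?e) = cycle_curve vs"
    unfolding cycle_curve_def A using g by (subst path_image_join) auto
  ultimately show thesis using g that[of "?g +++ ?e"] by auto
qed

text \<open>Extends the parity from grid points to the whole plane, constant on half-open unit
  squares; on a grid line \<open>floor\<close> selects the face above or to the right.\<close>

definition odd_face :: "(nat \<times> nat) list \<Rightarrow> complex \<Rightarrow> bool" where
  "odd_face vs z \<longleftrightarrow> odd (crossings (cyclic_arcs vs) \<lfloor>Re z\<rfloor> \<lfloor>Im z\<rfloor>)"

lemma odd_face_grid_point: "odd_face vs (grid_point p) \<longleftrightarrow> odd (crossings_at (cyclic_arcs vs) p)"
  by (simp add: odd_face_def)

text \<open>The interval is the open unit cell around x when x is not an integer, and (x - 1, x + 1)
  when it is; only in the second case can the floor drop.\<close>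

lemma floor_near:
  fixes x x' :: real
  assumes "real_of_int \<lceil>x\<rceil> - 1 < x'" "x' < real_of_int \<lfloor>x\<rfloor> + 1"
  shows "\<lfloor>x'\<rfloor> = \<lfloor>x\<rfloor> \<or> \<lfloor>x'\<rfloor> = \<lfloor>x\<rfloor> - 1 \<and> x = real_of_int \<lfloor>x\<rfloor>"
proof (cases "x = real_of_int \<lfloor>x\<rfloor>")
  case True
  then have "\<lceil>x\<rceil> = \<lfloor>x\<rfloor>" by (metis ceiling_of_int)
  then show ?thesis using assms True by linarith
next
  case False
  then have "\<lceil>x\<rceil> = \<lfloor>x\<rfloor> + 1" by linarith
  then show ?thesis using assms by linarith
qed

text \<open>U consists of the cells that touch z: one, two across an edge, or four around a grid
  point. The passage from z' to z changes the column first, in the row of z', and then the row, in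
  the column of z; an edge of the cycle crossed on the way would contain z.\<close>

lemma odd_face_locally_constant:
  assumes cyc: "grid_cycle vs" and z: "z \<notin> cycle_curve vs"
  obtains U where "open U" "z \<in> U" "\<And>z'. z' \<in> U \<Longrightarrow> odd_face vs z' = odd_face vs z"
proof -
  define U where "U = {z'. real_of_int \<lceil>Re z\<rceil> - 1 < Re z' \<and> Re z' < real_of_int \<lfloor>Re z\<rfloor> + 1 \<and>
    real_of_int \<lceil>Im z\<rceil> - 1 < Im z' \<and> Im z' < real_of_int \<lfloor>Im z\<rfloor> + 1}"
  let ?A = "cyclic_arcs vs"
  let ?X = "\<lfloor>Re z\<rfloor>" and ?Y = "\<lfloor>Im z\<rfloor>"
  have adj: "\<forall>(p, q) \<in> set ?A. grid_adj p q" using cyc unfolding grid_cycle_def by blast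
  have off: "z \<notin> grid_segment p q" if "(p, q) \<in> set ?A" for p q
    using z that unfolding cycle_curve_def by blast
  have "open U" unfolding U_def
    by (intro open_Collect_conj open_Collect_less continuous_intros)
  moreover have "z \<in> U" unfolding U_def by auto linarith+
  moreover have "odd_face vs z' = odd_face vs z" if "z' \<in> U" for z'
  proof -
    let ?X' = "\<lfloor>Re z'\<rfloor>" and ?Y' = "\<lfloor>Im z'\<rfloor>"
    have X: "?X' = ?X \<or> ?X' = ?X - 1 \<and> Re z = of_int ?X"
      and Y: "?Y' = ?Y \<or> ?Y' = ?Y - 1 \<and> Im z = of_int ?Y"
      using that floor_near[of "Re z" "Re z'"] floor_near[of "Im z" "Im z'"]
      unfolding U_def by blast+
    have "crossings ?A ?X' ?Y' = crossings ?A ?X ?Y'"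
    proof (cases "?X' = ?X")
      case False
      have "\<not> (fst p = fst q \<and> int (fst p) = ?X \<and> int (min (snd p) (snd q)) = ?Y')"
        if pq: "(p, q) \<in> set ?A" for p q
      proof
        assume *: "fst p = fst q \<and> int (fst p) = ?X \<and> int (min (snd p) (snd q)) = ?Y'"
        have "grid_adj p q" using adj pq by blast
        then show False
        proof (cases rule: grid_segment_cases)
          case (horizontal x y)
          then show False using * by (auto simp: doubleton_eq_iff)
        next
          case (vertical x y)
          then have "int x = ?X" "int y = ?Y'" using * by (auto simp: doubleton_eq_iff)
          then have "real x = of_int ?X" "real y = of_int ?Y'" by (metis of_int_of_nat_eq)+
          moreover have "Re z = of_int ?X" using X False by blast
          moreover have "of_int ?Y' \<le> Im z" "Im z \<le> of_int ?Y' + 1" using Y by linarith+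
          ultimately have "z \<in> grid_segment p q" unfolding vertical by simp
          with off[OF pq] show False by blast
        qed
      qed
      then have "crossings ?A ?X ?Y' = crossings ?A (?X - 1) ?Y'"
        by (intro crossings_horizontal_step) blast
      then show ?thesis using X False by simp
    qed simp
    moreover have "odd (crossings ?A ?X ?Y') = odd (crossings ?A ?X ?Y)"
    proof (cases "?Y' = ?Y")
      case False
      have "\<not> (snd p = snd q \<and> int (snd p) = ?Y \<and> int (min (fst p) (fst q)) = ?X)"
        if pq: "(p, q) \<in> set ?A" for p q
      proof
        assume *: "snd p = snd q \<and> int (snd p) = ?Y \<and> int (min (fst p) (fst q)) = ?X"
        have "grid_adj p q" using adj pq by blast
        then show False
        proof (cases rule: grid_segment_cases)
          case (vertical x y)
          then show False using * by (auto simp: doubleton_eq_iff)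
        next
          case (horizontal x y)
          then have "int x = ?X" "int y = ?Y" using * by (auto simp: doubleton_eq_iff)
          then have "real x = of_int ?X" "real y = of_int ?Y" by (metis of_int_of_nat_eq)+
          moreover have "Im z = of_int ?Y" using Y False by blast
          moreover have "of_int ?X \<le> Re z" "Re z \<le> of_int ?X + 1" by linarith+
          ultimately have "z \<in> grid_segment p q" unfolding horizontal by simp
          with off[OF pq] show False by blast
        qed
      qed
      then have "odd (crossings ?A ?X ?Y) = odd (crossings ?A ?X (?Y - 1))"
        by (intro crossings_vertical_step[OF adj]) blast
      then show ?thesis using Y False by simp
    qed simp
    ultimately show ?thesis unfolding odd_face_def by simp
  qed
  ultimately show thesis using that by blast
qed

lemma compact_cycle_curve: "compact (cycle_curve vs)"
  unfolding cycle_curve_def by (intro compact_UN) auto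

lemma odd_face_constant_on_connected:
  assumes "grid_cycle vs" "connected S" "S \<inter> cycle_curve vs = {}" "z \<in> S" "z' \<in> S"
  shows "odd_face vs z = odd_face vs z'"
proof -
  let ?T = "\<lambda>b. {z. z \<notin> cycle_curve vs \<and> odd_face vs z = b}"
  have op: "open (?T b)" for b
  proof (subst open_subopen, intro ballI)
    fix z assume "z \<in> ?T b"
    then have z: "z \<notin> cycle_curve vs" "odd_face vs z = b" by auto
    obtain U where U: "open U" "z \<in> U" "\<And>z'. z' \<in> U \<Longrightarrow> odd_face vs z' = odd_face vs z"
      using odd_face_locally_constant[OF assms(1) z(1)] by blast
    have "open (U - cycle_curve vs)"
      using U(1) compact_imp_closed[OF compact_cycle_curve] by (rule open_Diff)
    then show "\<exists>T. open T \<and> z \<in> T \<and> T \<subseteq> ?T b"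
    proof (intro exI[of _ "U - cycle_curve vs"] conjI subsetI)
      show "z \<in> U - cycle_curve vs" using U z by blast
      fix z' assume "z' \<in> U - cycle_curve vs"
      then show "z' \<in> ?T b" using U(3)[of z'] z(2) by blast
    qed
  qed
  have "?T True \<inter> S = {} \<or> ?T False \<inter> S = {}"
  proof (rule connectedD[OF assms(2) op op])
    show "S \<subseteq> ?T True \<union> ?T False" using assms(3) by blast
  qed blast
  then show ?thesis using assms(3-5) by blast
qed

lemma odd_face_bounded:
  assumes "grid_cycle vs"
  shows "bounded {z. odd_face vs z}"
proof -
  define M where "M = Max (fst ` set vs \<union> snd ` set vs)"
  have M: "fst p \<le> M" "snd p \<le> M" if "p \<in> set vs" for p
    unfolding M_def using that by (auto intro!: Max_ge)
  have adj: "\<forall>(p, q) \<in> set (cyclic_arcs vs). grid_adj p q"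
    using assms unfolding grid_cycle_def by blast
  have "{z. odd_face vs z} \<subseteq> cbox (Complex 0 0) (Complex (M + 1) (M + 1))"
  proof
    fix z assume "z \<in> {z. odd_face vs z}"
    then have odd: "odd (crossings (cyclic_arcs vs) \<lfloor>Re z\<rfloor> \<lfloor>Im z\<rfloor>)"
      by (simp add: odd_face_def)
    then have "filter (crosses \<lfloor>Re z\<rfloor> \<lfloor>Im z\<rfloor>) (cyclic_arcs vs) \<noteq> []"
      unfolding crossings_def by auto
    then obtain p q where pq: "(p, q) \<in> set (cyclic_arcs vs)" "crosses \<lfloor>Re z\<rfloor> \<lfloor>Im z\<rfloor> (p, q)"
      by (auto simp: filter_empty_conv)
    have "int (fst p) \<le> \<lfloor>Re z\<rfloor>" "int (min (snd p) (snd q)) = \<lfloor>Im z\<rfloor>" "snd p \<le> M"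
      using pq(2) M(2)[OF cyclic_arcs_ends(1)[OF pq(1)]] by (auto simp: crosses_def)
    then have 1: "0 \<le> \<lfloor>Re z\<rfloor>" "0 \<le> \<lfloor>Im z\<rfloor>" "\<lfloor>Im z\<rfloor> \<le> int M" by linarith+
    have "\<lfloor>Re z\<rfloor> < int M"
    proof (rule ccontr)
      assume *: "\<not> \<lfloor>Re z\<rfloor> < int M"
      \<comment> \<open>Right of all vertices the ray meets every arc that passes its height, so the
        count is the number of changes of side of a horizontal line, which is even.\<close>
      have "filter (crosses \<lfloor>Re z\<rfloor> \<lfloor>Im z\<rfloor>) (cyclic_arcs vs)
        = filter (\<lambda>(p, q). (int (snd p) \<le> \<lfloor>Im z\<rfloor>) \<noteq> (int (snd q) \<le> \<lfloor>Im z\<rfloor>)) (cyclic_arcs vs)"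
      proof (rule filter_cong[OF refl])
        fix e assume "e \<in> set (cyclic_arcs vs)"
        moreover obtain a b where ab: "e = (a, b)" by (cases e)
        ultimately have e: "(a, b) \<in> set (cyclic_arcs vs)" by simp
        have "grid_adj a b" using adj e by blast
        moreover have "int (fst a) \<le> \<lfloor>Re z\<rfloor>" using M(1)[OF cyclic_arcs_ends(1)[OF e]] * by simp
        ultimately show "crosses \<lfloor>Re z\<rfloor> \<lfloor>Im z\<rfloor> e
          = (case e of (p, q) \<Rightarrow> (int (snd p) \<le> \<lfloor>Im z\<rfloor>) \<noteq> (int (snd q) \<le> \<lfloor>Im z\<rfloor>))"
          unfolding ab by (cases rule: grid_adj_cases) (auto simp: crosses_def)
      qed
      then have "even (crossings (cyclic_arcs vs) \<lfloor>Re z\<rfloor> \<lfloor>Im z\<rfloor>)"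
        unfolding crossings_def
        using even_sign_changes_cycle[of "\<lambda>p. int (snd p) \<le> \<lfloor>Im z\<rfloor>" vs] by simp
      with odd show False by simp
    qed
    with 1 show "z \<in> cbox (Complex 0 0) (Complex (M + 1) (M + 1))"
      by (auto simp: in_cbox_complex_iff) linarith+
  qed
  then show ?thesis using bounded_subset bounded_cbox by blast
qed

text \<open>The component of z in the complement keeps odd parity throughout, and the odd region is
  bounded.\<close>

lemma odd_face_imp_inside:
  assumes "grid_cycle vs" "odd_face vs z" "z \<notin> cycle_curve vs"
  shows "z \<in> inside (cycle_curve vs)"
proof -
  let ?C = "connected_component_set (- cycle_curve vs) z"
  have "z \<in> ?C" using assms(3) by simp
  moreover have "?C \<inter> cycle_curve vs = {}"
    using connected_component_subset[of "- cycle_curve vs" z] by blast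
  ultimately have "?C \<subseteq> {z. odd_face vs z}"
    using odd_face_constant_on_connected[OF assms(1) connected_connected_component, of "- cycle_curve vs" z z]
      assms(2) by blast
  then show ?thesis
    unfolding inside_def using assms bounded_subset[OF odd_face_bounded[OF assms(1)]] by auto
qed

text \<open>The witness is the centre of the face at the lexicographically least vertex: its ray
  meets only the edge going up from that vertex, and half-integer coordinates keep it off every grid
  line.\<close>

lemma ex_odd_face:
  assumes "grid_cycle vs" "2 < length vs"
  obtains z where "odd_face vs z" "z \<notin> cycle_curve vs"
proof -
  obtain i j r us where us: "us = (i, j) # (Suc i, j) # r @ [(i, Suc j)]"
    "grid_cycle us" "set us = set vs" and
    ms: "mset (cyclic_arcs us) = mset (cyclic_arcs vs)
      \<or> mset (cyclic_arcs us) = mset (map prod.swap (cyclic_arcs vs))" and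
    lex: "\<forall>p \<in> set vs. i < fst p \<or> i = fst p \<and> j \<le> snd p"
    using grid_cycle_corner[OF assms] by metis
  define t where "t = (Suc i, j) # r @ [(i, Suc j)]"
  have ust: "us = (i, j) # t" unfolding us(1) t_def by simp
  have A: "cyclic_arcs us = ((i, j), (Suc i, j)) # path_arcs t @ [((i, Suc j), (i, j))]"
    unfolding ust t_def by (subst cyclic_arcs_Cons) auto
  have "crossings_at (path_arcs t) (i, j) = 0"
  proof (rule crossings_left_end)
    fix p q assume "(p, q) \<in> set (path_arcs t)"
    from path_arcs_ends[OF this] show "i \<le> fst p \<and> p \<noteq> (i, j) \<and> q \<noteq> (i, j)"
      using lex us(2) unfolding us(3)[symmetric] ust grid_cycle_def
      by (auto dest: less_imp_le)
  qed
  then have "crossings_at (cyclic_arcs us) (i, j) = 1"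
    unfolding A by (auto simp: crosses_def)
  moreover have "crossings (cyclic_arcs us) X Y = crossings (cyclic_arcs vs) X Y" for X Y
    using ms crossings_cong_mset crossings_swap by metis
  ultimately have one: "crossings_at (cyclic_arcs vs) (i, j) = 1" by metis
  let ?z = "Complex (real i + 1 / 2) (real j + 1 / 2)"
  have fl: "\<lfloor>real i + 1 / 2\<rfloor> = int i" "\<lfloor>real j + 1 / 2\<rfloor> = int j" by linarith+
  have "odd_face vs ?z" unfolding odd_face_def using one fl by simp
  moreover have "?z \<notin> grid_segment p q" if "(p, q) \<in> set (cyclic_arcs vs)" for p q
  proof -
    have ne: "real k + 1 / 2 \<noteq> real l" for k l :: nat
    proof
      assume "real k + 1 / 2 = real l"
      then have "real (2 * k + 1) = real (2 * l)" by simp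
      then have "2 * k + 1 = 2 * l" unfolding of_nat_eq_iff .
      then show False by presburger
    qed
    have "grid_adj p q" using that assms(1) unfolding grid_cycle_def by blast
    then show ?thesis
      by (cases rule: grid_segment_cases) (auto simp: ne)
  qed
  then have "?z \<notin> cycle_curve vs" unfolding cycle_curve_def by blast
  ultimately show thesis using that by blast
qed

text \<open>Odd points off the curve are inside by boundedness. Conversely, the Jordan curve theorem
  makes the inside connected, so the one odd point known in it forces odd parity everywhere. A
  doubled edge is a segment, with empty inside and every crossing counted twice.\<close>

theorem grid_point_inside_cycle_iff:
  assumes "grid_cycle vs"
  shows "grid_point p \<in> inside (cycle_curve vs)
    \<longleftrightarrow> p \<notin> set vs \<and> odd (crossings_at (cyclic_arcs vs) p)"
proof (cases "p \<in> set vs")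
  case True
  then have "p \<in> fst ` set (cyclic_arcs vs)" by (simp only: fst_set_cyclic_arcs)
  then obtain q where "(p, q) \<in> set (cyclic_arcs vs)" by (metis imageE prod.collapse)
  then have "grid_point p \<in> cycle_curve vs" unfolding cycle_curve_def by (rule UN_I) simp
  then show ?thesis using True inside_no_overlap[of "cycle_curve vs"] by blast
next
  case False
  have off: "grid_point p \<notin> cycle_curve vs"
  proof
    assume "grid_point p \<in> cycle_curve vs"
    then obtain a b where ab: "(a, b) \<in> set (cyclic_arcs vs)" "grid_point p \<in> grid_segment a b"
      unfolding cycle_curve_def by blast
    then have "p = a \<or> p = b"
      using assms unfolding grid_cycle_def by (intro grid_point_in_segment) auto
    then show False using cyclic_arcs_ends[OF ab(1)] False by auto
  qed
  show ?thesis
  proof (cases "length vs = 2")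
    case True
    then obtain a b where vs: "vs = [a, b]"
      by (auto simp: numeral_2_eq_2 length_Suc_conv)
    have "cycle_curve vs = grid_segment a b"
      unfolding cycle_curve_def vs by (simp add: closed_segment_commute)
    then have "inside (cycle_curve vs) = {}" by (simp add: inside_convex)
    moreover have "even (crossings (cyclic_arcs vs) X Y)" for X Y
      using crosses_swap[of X Y "(a, b)"] unfolding vs by simp
    ultimately show ?thesis by simp
  next
    case not2: False
    then have len: "2 < length vs" using assms unfolding grid_cycle_def by auto
    obtain c where c: "simple_path c" "pathfinish c = pathstart c" "path_image c = cycle_curve vs"
      using simple_closed_path_cycle[OF assms len] .
    have con: "connected (inside (cycle_curve vs))"
      using Jordan_inside_outside[OF c(1,2)] unfolding c(3) by blast
    obtain w where w: "odd_face vs w" "w \<notin> cycle_curve vs" using ex_odd_face[OF assms len] .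
    have win: "w \<in> inside (cycle_curve vs)" using odd_face_imp_inside[OF assms w] .
    have "odd_face vs (grid_point p)" if "grid_point p \<in> inside (cycle_curve vs)"
      using odd_face_constant_on_connected[OF assms con inside_no_overlap that win] w(1)
      by simp
    then show ?thesis
      using odd_face_imp_inside[OF assms _ off] False unfolding odd_face_grid_point by blast
  qed
qed

section \<open>The partition function as a determinant\<close>

text \<open>The graph of the permutation without its fixed points, which will be the
  monopoles.\<close>

definition moved_arcs :: "('a \<Rightarrow> 'a) \<Rightarrow> ('a \<times> 'a) set" where
  "moved_arcs p = {(x, p x) | x. p x \<noteq> x}"

definition orbit_arcs :: "('a \<Rightarrow> 'a) \<Rightarrow> 'a \<Rightarrow> ('a \<times> 'a) set" where
  "orbit_arcs p v = (\<lambda>x. (x, p x)) ` set (support p v)"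

definition permutation_loops :: "('a \<Rightarrow> 'a) \<Rightarrow> ('a \<times> 'a) set set" where
  "permutation_loops p = orbit_arcs p ` {v. p v \<noteq> v}"

lemma moved_arcs_inj: "moved_arcs p = moved_arcs q \<Longrightarrow> p = q"
proof
  fix x assume eq: "moved_arcs p = moved_arcs q"
  have "(x, y) \<in> moved_arcs r \<longleftrightarrow> r x = y \<and> y \<noteq> x" for r :: "'a \<Rightarrow> 'a" and y
    unfolding moved_arcs_def by auto
  then show "p x = q x" using eq by metis
qed

lemma sign_cycle_of_list:
  assumes "distinct cs" "cs \<noteq> []"
  shows "sign (cycle_of_list cs) = (- 1) ^ (length cs - 1)"
  using assms
proof (induction cs rule: cycle_of_list.induct)
  case (1 i j cs)
  have "sign (cycle_of_list (i # j # cs))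
      = sign (Transposition.transpose i j) * sign (cycle_of_list (j # cs))"
    unfolding cycle_of_list.simps
    by (intro sign_compose permutation_swap_id permutation_of_cycle)
  then show ?case using 1 by (simp add: sign_swap_id del: cycle_of_list.simps)
qed auto

lemma cycle_arcs_eq_cycle_of_list:
  assumes "distinct vs"
  shows "cycle_arcs vs = (\<lambda>x. (x, cycle_of_list vs x)) ` set vs"
proof -
  have "rotate1 vs = map (cycle_of_list vs) vs"
    using cyclic_rotation[OF assms, of 1] by simp
  then have "cycle_arcs vs = set (zip (map id vs) (map (cycle_of_list vs) vs))"
    unfolding cycle_arcs_def by simp
  also have "\<dots> = (\<lambda>x. (x, cycle_of_list vs x)) ` set vs"
    unfolding zip_map_map by (auto simp: zip_same_conv_map)
  finally show ?thesis .
qed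

lemma Field_cycle_arcs: "Field (cycle_arcs vs) = set vs"
  unfolding Field_def Domain_fst Range_snd cycle_arcs_def
  by (simp only: fst_set_cyclic_arcs snd_set_cyclic_arcs Un_absorb)

text \<open>On \<open>vs\<close> the permutation agrees with the cyclic shift of \<open>vs\<close>,
  so its iterates starting at u run through all of \<open>vs\<close>: a loop inside the graph of p
  is a complete orbit.\<close>

lemma cycle_arcs_eq_orbit_arcs:
  assumes "distinct vs" "cycle_arcs vs \<subseteq> moved_arcs p" "permutation p" "u \<in> set vs"
  shows "cycle_arcs vs = orbit_arcs p u"
proof -
  let ?c = "cycle_of_list vs"
  have pc: "p x = ?c x" if "x \<in> set vs" for x
    using assms(2) that unfolding cycle_arcs_eq_cycle_of_list[OF assms(1)] moved_arcs_def by auto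
  obtain i where i: "i < length vs" "vs ! i = u" using assms(4) by (metis in_set_conv_nth)
  have ck: "(?c ^^ k) u = vs ! ((k + i) mod length vs)" for k
    using i cyclic_rotation[OF assms(1), of k] nth_rotate[of i vs k]
    by (metis nth_map)
  have pk: "(p ^^ k) u = (?c ^^ k) u" for k
  proof (induction k)
    case (Suc k)
    have "(?c ^^ k) u \<in> set vs" unfolding ck using i by (intro nth_mem mod_less_divisor) auto
    then show ?case using Suc pc by simp
  qed simp
  have "set (support p u) = range (\<lambda>k. (?c ^^ k) u)"
    using support_set[OF assms(3), of u] pk by simp
  also have "\<dots> = set vs"
  proof (intro equalityI subsetI)
    fix x assume "x \<in> range (\<lambda>k. (?c ^^ k) u)"
    then show "x \<in> set vs" unfolding ck using i by (auto intro!: nth_mem mod_less_divisor)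
  next
    fix x assume "x \<in> set vs"
    then obtain j where j: "j < length vs" "vs ! j = x" by (metis in_set_conv_nth)
    \<comment> \<open>Going from index i to index j takes j - i steps; adding a full turn avoids
      truncated subtraction when j < i.\<close>
    have "(j + length vs - i + i) mod length vs = j" using i j by simp
    then have "x = (?c ^^ (j + length vs - i)) u" unfolding ck using j by simp
    then show "x \<in> range (\<lambda>k. (?c ^^ k) u)" by blast
  qed
  finally show ?thesis
    unfolding orbit_arcs_def cycle_arcs_eq_cycle_of_list[OF assms(1)] using pc by auto
qed

lemma cycle_arcs_support:
  assumes "permutation p"
  shows "cycle_arcs (support p v) = orbit_arcs p v"
proof -
  let ?n = "least_power p v" and ?vs = "support p v"
  have n: "?n > 0" "(p ^^ ?n) v = v" using least_power_of_permutation[OF assms] by auto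
  have "rotate1 ?vs = map p ?vs"
  proof (intro nth_equalityI)
    fix i assume "i < length (rotate1 ?vs)"
    then have i: "i < ?n" by simp
    have "rotate1 ?vs ! i = (p ^^ (Suc i mod ?n)) v"
      using i n by (simp add: nth_rotate1)
    also have "\<dots> = (p ^^ Suc i) v"
      using i n by (cases "Suc i = ?n") auto
    finally show "rotate1 ?vs ! i = map p ?vs ! i" using i by simp
  qed simp
  then have "cycle_arcs ?vs = set (zip (map id ?vs) (map p ?vs))"
    unfolding cycle_arcs_def by simp
  also have "\<dots> = (\<lambda>x. (x, p x)) ` set ?vs"
    unfolding zip_map_map by (auto simp: zip_same_conv_map)
  finally show ?thesis unfolding orbit_arcs_def .
qed

lemma directed_loopE:
  assumes "directed_loop G l"
  obtains vs where "distinct vs" "set vs \<subseteq> verts G" "2 \<le> length vs" "even (length vs)"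
    "l = cycle_arcs vs" "\<And>u v. (u, v) \<in> l \<Longrightarrow> {u, v} \<in> edges G"
  using assms unfolding directed_loop_def by (auto split: prod.splits)

lemma configuration_loop: "configuration G C \<Longrightarrow> l \<in> C \<Longrightarrow> directed_loop G l"
  unfolding configuration_def by simp

lemma configuration_disjoint:
  "configuration G C \<Longrightarrow> l \<in> C \<Longrightarrow> l' \<in> C \<Longrightarrow> l \<noteq> l' \<Longrightarrow> Field l \<inter> Field l' = {}"
  unfolding configuration_def by simp

text \<open>What a determinant needs in order to expand into loops. \<open>closed_walk_even\<close>
  makes every nontrivial orbit of a permutation along edges an admissible loop, with sign -1 as an
  even cycle; the minus sign in \<open>loop_weight_K\<close> absorbs this sign. Geometry enters only
  through that assumption.\<close>

locale loop_determinant =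
  fixes G :: "('v, 'b) weighted_plane_graph_scheme" and K :: "'v \<Rightarrow> 'v \<Rightarrow> real"
  assumes finite_verts: "finite (verts G)"
    and edges_irrefl: "{u, u} \<notin> edges G"
    and closed_walk_even: "distinct vs \<Longrightarrow> 2 \<le> length vs \<Longrightarrow>
      \<forall>(u, v) \<in> cycle_arcs vs. {u, v} \<in> edges G \<Longrightarrow> even (length vs)"
    and loop_weight_K: "directed_loop G l \<Longrightarrow> loop_weight G l = - (\<Prod>(u, v)\<in>l. K u v)"
    and K_diag: "v \<in> verts G \<Longrightarrow> K v v = vertex_weight G v"
    and K_nonadjacent: "u \<in> verts G \<Longrightarrow> v \<in> verts G \<Longrightarrow> u \<noteq> v \<Longrightarrow> {u, v} \<notin> edges G \<Longrightarrow>
      K u v = 0"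
begin

definition edge_permutations :: "('v \<Rightarrow> 'v) set" where
  "edge_permutations =
    {p. p permutes verts G \<and> (\<forall>v \<in> verts G. p v = v \<or> {v, p v} \<in> edges G)}"

lemma finite_configuration: "configuration G C \<Longrightarrow> finite C"
proof -
  assume C: "configuration G C"
  have "C \<subseteq> Pow (verts G \<times> verts G)"
  proof
    fix l assume "l \<in> C"
    with C obtain vs where "set vs \<subseteq> verts G" "l = cycle_arcs vs"
      by (metis configuration_loop directed_loopE)
    moreover have "set (cyclic_arcs vs) \<subseteq> set vs \<times> set vs"
      using cyclic_arcs_ends by (intro subrelI SigmaI)
    ultimately show "l \<in> Pow (verts G \<times> verts G)"
      unfolding cycle_arcs_def by blast
  qed
  then show ?thesis using finite_verts finite_subset by blast
qed

text \<open>The loops are composed one at a time as disjoint cycles; each has even length and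
  multiplies the sign by -1.\<close>

lemma configuration_imp_permutation:
  assumes "configuration G C"
  shows "\<exists>p. p permutes verts G \<and> moved_arcs p = \<Union>C \<and> sign p = (- 1) ^ card C"
  using finite_configuration[OF assms] assms
proof (induction C rule: finite_induct)
  case empty
  show ?case
    by (intro exI[of _ id] conjI permutes_id) (simp_all add: moved_arcs_def)
next
  case (insert l C)
  have "configuration G C" using insert.prems unfolding configuration_def by blast
  then obtain p where p: "p permutes verts G" "moved_arcs p = \<Union>C" "sign p = (- 1) ^ card C"
    using insert.IH by blast
  obtain vs where vs: "distinct vs" "set vs \<subseteq> verts G" "length vs \<ge> 2" "even (length vs)"
    "l = cycle_arcs vs" "\<And>u v. (u, v) \<in> l \<Longrightarrow> {u, v} \<in> edges G"
    using configuration_loop[OF insert.prems, of l] by (auto elim: directed_loopE)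
  let ?c = "cycle_of_list vs"
  have l: "l = (\<lambda>x. (x, ?c x)) ` set vs"
    unfolding vs(5) by (rule cycle_arcs_eq_cycle_of_list[OF vs(1)])
  have cm: "?c x \<noteq> x" if "x \<in> set vs" for x
  proof
    assume "?c x = x"
    then have "(x, x) \<in> l" unfolding l using that by force
    then show False using vs(6) edges_irrefl by blast
  qed
  have fixp: "p x = x" if "x \<in> set vs" for x
  proof (rule ccontr)
    assume "p x \<noteq> x"
    then have "(x, p x) \<in> \<Union>C" unfolding p(2)[symmetric] moved_arcs_def by blast
    then obtain l' where l': "l' \<in> C" "x \<in> Field l'" by (auto simp: Field_def)
    moreover have "x \<in> Field l" unfolding vs(5) Field_cycle_arcs by (rule that)
    ultimately have "Field l \<inter> Field l' \<noteq> {}" by blast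
    moreover have "l \<noteq> l'" using l' insert.hyps by blast
    ultimately show False using configuration_disjoint[OF insert.prems, of l l'] l'(1) by simp
  qed
  have cs: "?c permutes set vs" by (rule cycle_permutes)
  have cin: "?c x \<in> set vs \<longleftrightarrow> x \<in> set vs" for x using permutes_in_image[OF cs] .
  have "p \<circ> ?c permutes verts G"
    using permutes_compose[OF permutes_subset[OF cs vs(2)] p(1)] .
  moreover have "moved_arcs (p \<circ> ?c) = \<Union>(insert l C)"
  proof -
    have "(p \<circ> ?c) x = (if x \<in> set vs then ?c x else p x)" for x
      using fixp cin permutes_not_in[OF cs] by auto
    then have "moved_arcs (p \<circ> ?c) = l \<union> moved_arcs p"
      unfolding moved_arcs_def l using cm fixp by (auto simp del: comp_apply)
    then show ?thesis using p(2) by simp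
  qed
  moreover have "sign (p \<circ> ?c) = (- 1) ^ card (insert l C)"
  proof -
    have "sign (p \<circ> ?c) = sign p * sign ?c"
      using p(1) finite_verts
      by (intro sign_compose permutation_of_cycle) (auto simp: permutation_permutes)
    moreover have "sign ?c = - 1"
    proof -
      have "odd (length vs - 1)" using vs(3,4) by presburger
      then show ?thesis using sign_cycle_of_list[OF vs(1)] vs(3) by fastforce
    qed
    ultimately show ?thesis using p(3) insert.hyps by simp
  qed
  ultimately show ?case by blast
qed

lemma configuration_eq_permutation_loops:
  assumes "configuration G C" "moved_arcs p = \<Union>C" "permutation p"
  shows "C = permutation_loops p"
proof -
  have loop: "l = orbit_arcs p u" if l: "l \<in> C" "u \<in> Field l" for l u
  proof -
    obtain vs where vs: "distinct vs" "l = cycle_arcs vs"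
      using configuration_loop[OF assms(1) l(1)] by (auto elim: directed_loopE)
    show ?thesis
      using cycle_arcs_eq_orbit_arcs[OF vs(1) _ assms(3), of u] l assms(2)
      unfolding vs(2) Field_cycle_arcs by blast
  qed
  have moved: "p u \<noteq> u \<longleftrightarrow> (\<exists>l\<in>C. u \<in> Domain l)" for u
  proof -
    have "p u \<noteq> u \<longleftrightarrow> u \<in> Domain (moved_arcs p)" unfolding moved_arcs_def by auto
    then show ?thesis unfolding assms(2) by auto
  qed
  show ?thesis
  proof (intro equalityI subsetI)
    fix l assume l: "l \<in> C"
    then obtain vs where "length vs \<ge> 2" "l = cycle_arcs vs"
      using configuration_loop[OF assms(1)] by (metis directed_loopE)
    then have "Field l \<noteq> {}" by (auto simp: Field_cycle_arcs)
    then obtain u where "u \<in> Domain l" by (auto simp: Field_def)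
    with l loop[OF l, of u] show "l \<in> permutation_loops p"
      unfolding permutation_loops_def using moved[of u] by (auto simp: Field_def)
  next
    fix l assume "l \<in> permutation_loops p"
    then obtain u where "p u \<noteq> u" "l = orbit_arcs p u" unfolding permutation_loops_def by auto
    then show "l \<in> C" using moved[of u] loop by (auto simp: Field_def)
  qed
qed

lemma permutation_loops_configuration:
  assumes "p \<in> edge_permutations"
  shows "configuration G (permutation_loops p) \<and> \<Union>(permutation_loops p) = moved_arcs p"
proof -
  have p: "p permutes verts G" "\<And>v. v \<in> verts G \<Longrightarrow> p v = v \<or> {v, p v} \<in> edges G"
    using assms unfolding edge_permutations_def by auto
  have perm: "permutation p" using p(1) finite_verts by (auto simp: permutation_permutes)
  have self: "v \<in> set (support p v)" for v
    unfolding support_set[OF perm] by (rule range_eqI[of _ _ 0]) simp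
  have orb: "p x \<noteq> x" if "p v \<noteq> v" "x \<in> set (support p v)" for x v
    using support_coverture[OF perm] that by blast
  have U: "\<Union>(permutation_loops p) = moved_arcs p"
    unfolding permutation_loops_def moved_arcs_def orbit_arcs_def using orb self by blast
  have "directed_loop G (orbit_arcs p v)" if v: "p v \<noteq> v" for v
  proof -
    let ?vs = "support p v"
    have arcs: "\<forall>(u, w) \<in> cycle_arcs ?vs. {u, w} \<in> edges G"
      unfolding cycle_arcs_support[OF perm] orbit_arcs_def
      using orb[OF v] p permutes_not_in[OF p(1)] by fastforce
    have len: "2 \<le> length ?vs" using least_power_gt_one[OF perm v] by simp
    have "set ?vs \<subseteq> verts G"
      using orb[OF v] permutes_not_in[OF p(1)] by blast
    then show ?thesis
      unfolding directed_loop_def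
      using arcs len closed_walk_even[OF cycle_of_permutation[OF perm] len arcs]
        cycle_of_permutation[OF perm] cycle_arcs_support[OF perm] by metis
  qed
  moreover have "Field (orbit_arcs p v) \<inter> Field (orbit_arcs p w) = {}"
    if "orbit_arcs p v \<noteq> orbit_arcs p w" for v w
  proof -
    have "set (support p v) \<noteq> set (support p w)" using that unfolding orbit_arcs_def by metis
    then have "set (support p v) \<inter> set (support p w) = {}"
      using disjoint_support[OF perm] unfolding disjoint_def by blast
    then show ?thesis
      unfolding cycle_arcs_support[OF perm, symmetric] Field_cycle_arcs .
  qed
  ultimately have "configuration G (permutation_loops p)"
    unfolding configuration_def permutation_loops_def by blast
  with U show ?thesis by blast
qed

text \<open>The minus signs of \<open>loop_weight_K\<close> multiply to (-1)^(number of loops),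
  which is also the sign of p. Moved vertices then account for the loop factors and fixed ones for
  the monopoles.\<close>

lemma configuration_weight_permutation_loops:
  assumes "p \<in> edge_permutations"
  shows "configuration_weight G (permutation_loops p)
    = of_int (sign p) * (\<Prod>v\<in>verts G. K v (p v))"
proof -
  let ?C = "permutation_loops p"
  have C: "configuration G ?C" and U: "\<Union>?C = moved_arcs p"
    using permutation_loops_configuration[OF assms] by auto
  have p: "p permutes verts G" using assms unfolding edge_permutations_def by auto
  have sgn: "sign p = (- 1) ^ card ?C"
    using configuration_imp_permutation[OF C] moved_arcs_inj unfolding U by metis
  have fin: "finite l" if "l \<in> ?C" for l
    by (rule directed_loopE[OF configuration_loop[OF C that]]) (simp add: cycle_arcs_def)
  have ne: "\<forall>l\<in>?C. \<forall>l'\<in>?C. l \<noteq> l' \<longrightarrow> l \<inter> l' = {}"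
  proof (intro ballI impI)
    fix l l' assume "l \<in> ?C" "l' \<in> ?C" "l \<noteq> l'"
    from configuration_disjoint[OF C this] show "l \<inter> l' = {}"
      by (auto simp: Field_def)
  qed
  have "(\<Prod>l\<in>?C. loop_weight G l) = (\<Prod>l\<in>?C. - 1 * (\<Prod>e\<in>l. K (fst e) (snd e)))"
    using configuration_loop[OF C] by (intro prod.cong) (auto simp: loop_weight_K split_beta)
  also have "\<dots> = (- 1) ^ card ?C * (\<Prod>l\<in>?C. \<Prod>e\<in>l. K (fst e) (snd e))"
    by (simp only: prod.distrib prod_constant)
  also have "(\<Prod>l\<in>?C. \<Prod>e\<in>l. K (fst e) (snd e)) = (\<Prod>e\<in>\<Union>?C. K (fst e) (snd e))"
    using prod.Union_disjoint[of ?C "\<lambda>e. K (fst e) (snd e)"] fin ne by simp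
  also have "\<dots> = (\<Prod>v\<in>{v. p v \<noteq> v}. K v (p v))"
    unfolding U moved_arcs_def
    by (rule prod.reindex_bij_witness[of _ "\<lambda>v. (v, p v)" fst]) auto
  finally have loops: "(\<Prod>l\<in>?C. loop_weight G l)
    = (- 1) ^ card ?C * (\<Prod>v\<in>{v. p v \<noteq> v}. K v (p v))" .
  have "(\<Union>l\<in>?C. Field l) = Field (\<Union>?C)" unfolding Field_def by blast
  also have "\<dots> = {v. p v \<noteq> v}"
  proof -
    have "p (p x) \<noteq> p x" if "p x \<noteq> x" for x
      using that permutes_inj[OF p] by (auto dest: injD)
    then show ?thesis unfolding U moved_arcs_def Field_def by auto
  qed
  finally have mono: "monopoles G ?C = verts G - {v. p v \<noteq> v}" unfolding monopoles_def by simp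
  have sub: "{v. p v \<noteq> v} \<subseteq> verts G" using permutes_not_in[OF p] by blast
  have "(\<Prod>v\<in>verts G. K v (p v))
    = (\<Prod>v\<in>verts G - {v. p v \<noteq> v}. K v (p v)) * (\<Prod>v\<in>{v. p v \<noteq> v}. K v (p v))"
    by (rule prod.subset_diff[OF sub finite_verts])
  also have "(\<Prod>v\<in>verts G - {v. p v \<noteq> v}. K v (p v)) = (\<Prod>v\<in>monopoles G ?C. vertex_weight G v)"
    unfolding mono by (intro prod.cong) (auto simp: K_diag)
  finally show ?thesis
    unfolding configuration_weight_def loops sgn by simp
qed

theorem partition_function_eq_determinant:
  "partition_function G
    = (\<Sum>p | p permutes verts G. of_int (sign p) * (\<Prod>v\<in>verts G. K v (p v)))"
proof -
  have bij: "bij_betw permutation_loops edge_permutations {C. configuration G C}"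
  proof (intro bij_betw_imageI inj_onI equalityI subsetI)
    fix p q assume "p \<in> edge_permutations" "q \<in> edge_permutations"
      "permutation_loops p = permutation_loops q"
    then show "p = q" using permutation_loops_configuration moved_arcs_inj by metis
  next
    fix C assume "C \<in> permutation_loops ` edge_permutations"
    then show "C \<in> {C. configuration G C}" using permutation_loops_configuration by auto
  next
    fix C assume "C \<in> {C. configuration G C}"
    then have C: "configuration G C" by simp
    then obtain p where p: "p permutes verts G" "moved_arcs p = \<Union>C"
      using configuration_imp_permutation[OF C] by blast
    then have "permutation p" using finite_verts by (auto simp: permutation_permutes)
    then have "C = permutation_loops p" using configuration_eq_permutation_loops[OF C p(2)] by blast
    moreover have "p v = v \<or> {v, p v} \<in> edges G" for v
    proof (rule disjCI)
      assume "{v, p v} \<notin> edges G"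
      then have "(v, p v) \<notin> \<Union>C"
        using configuration_loop[OF C] by (auto elim: directed_loopE)
      then show "p v = v" unfolding p(2)[symmetric] moved_arcs_def by blast
    qed
    ultimately show "C \<in> permutation_loops ` edge_permutations"
      using p(1) unfolding edge_permutations_def by blast
  qed
  have "partition_function G = (\<Sum>p\<in>edge_permutations. configuration_weight G (permutation_loops p))"
    unfolding partition_function_def by (rule sum.reindex_bij_betw[OF bij, symmetric])
  also have "\<dots> = (\<Sum>p\<in>edge_permutations. of_int (sign p) * (\<Prod>v\<in>verts G. K v (p v)))"
    by (intro sum.cong refl configuration_weight_permutation_loops)
  also have "\<dots> = (\<Sum>p | p permutes verts G. of_int (sign p) * (\<Prod>v\<in>verts G. K v (p v)))"
  \<comment> \<open>A permutation outside \<open>edge_permutations\<close> moves some vertex along a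
    non-edge, where K vanishes.\<close>
  proof (rule sum.mono_neutral_left)
    show "finite {p. p permutes verts G}" using finite_verts by (rule finite_permutations)
    show "\<forall>p\<in>{p. p permutes verts G} - edge_permutations.
        of_int (sign p) * (\<Prod>v\<in>verts G. K v (p v)) = 0"
    proof
      fix p assume "p \<in> {p. p permutes verts G} - edge_permutations"
      then obtain v where "v \<in> verts G" "p v \<in> verts G" "p v \<noteq> v" "{v, p v} \<notin> edges G"
        unfolding edge_permutations_def by (auto simp: permutes_in_image)
      then have "\<exists>v\<in>verts G. K v (p v) = 0" using K_nonadjacent[of v "p v"] by auto
      then show "of_int (sign p) * (\<Prod>v\<in>verts G. K v (p v)) = 0"
        using finite_verts by (simp add: prod_zero_iff)
    qed
  qed (auto simp: edge_permutations_def)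
  finally show ?thesis .
qed

end

section \<open>The grid graph as an instance of the locale\<close>

lemma grid_graph_sel [simp]:
  "verts (grid_graph m n a b z) = {1..m} \<times> {1..n}"
  "vertex_weight (grid_graph m n a b z) v = z"
  by (simp_all add: grid_graph_def)

lemma place_grid_graph: "place (grid_graph m n a b z) = grid_point"
  by (auto simp: grid_graph_def grid_point_def)

lemma edge_grid_graph_iff:
  "{p, q} \<in> edges (grid_graph m n a b z)
    \<longleftrightarrow> grid_adj p q \<and> p \<in> {1..m} \<times> {1..n} \<and> q \<in> {1..m} \<times> {1..n}"
    (is "_ \<longleftrightarrow> ?R")
proof
  assume "{p, q} \<in> edges (grid_graph m n a b z)"
  then show ?R
    unfolding grid_graph_def by (auto simp: doubleton_eq_iff grid_adj_def)
next
  assume R: ?R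
  then have "grid_adj p q" by blast
  then show "{p, q} \<in> edges (grid_graph m n a b z)"
  proof (cases rule: grid_adj_cases)
    case (right x y)
    then show ?thesis using R by (auto simp: grid_graph_def)
  next
    case (left x y)
    then show ?thesis using R by (auto simp: grid_graph_def doubleton_eq_iff)
  next
    case (up x y)
    then show ?thesis using R by (auto simp: grid_graph_def)
  next
    case (down x y)
    then show ?thesis using R by (auto simp: grid_graph_def doubleton_eq_iff)
  qed
qed

definition grid_kernel :: "nat \<Rightarrow> nat \<Rightarrow> real \<Rightarrow> real \<Rightarrow> real \<Rightarrow> nat \<times> nat \<Rightarrow> nat \<times> nat \<Rightarrow> real" where
  "grid_kernel m n a b z u v =
    (if u = v then z else orient u v * edge_weight (grid_graph m n a b z) {u, v})"

lemma grid_cycle_if_arcs_edges: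
  assumes "distinct vs" "2 \<le> length vs"
    and "\<forall>(u, v) \<in> cycle_arcs vs. {u, v} \<in> edges (grid_graph m n a b z)"
  shows "grid_cycle vs"
  using assms unfolding grid_cycle_def cycle_arcs_def by (auto simp: edge_grid_graph_iff)

lemma num_enclosed_grid_cycle:
  assumes "grid_cycle vs"
  shows "num_enclosed (grid_graph m n a b z) (cycle_arcs vs)
    = card (odd_vertices ({1..m} \<times> {1..n}) vs)"
proof -
  have "loop_curve (grid_graph m n a b z) (cycle_arcs vs) = cycle_curve vs"
    unfolding loop_curve_def cycle_curve_def place_grid_graph cycle_arcs_def ..
  then show ?thesis
    unfolding num_enclosed_def place_grid_graph odd_vertices_def
    using grid_point_inside_cycle_iff[OF assms] by (auto intro!: arg_cong[of _ _ card])
qed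

interpretation grid: loop_determinant "grid_graph m n a b z" "grid_kernel m n a b z"
  for m n a b z
proof
  let ?G = "grid_graph m n a b z" and ?K = "grid_kernel m n a b z"
  show "finite (verts ?G)" by simp
  show "{u, u} \<notin> edges ?G" for u
    unfolding edge_grid_graph_iff by (simp add: grid_adj_def)
  show "even (length vs)"
    if "distinct vs" "2 \<le> length vs" "\<forall>(u, v) \<in> cycle_arcs vs. {u, v} \<in> edges ?G" for vs
    using grid_cycle_even_length[OF grid_cycle_if_arcs_edges[OF that]] .
  show "loop_weight ?G l = - (\<Prod>(u, v)\<in>l. ?K u v)" if dl: "directed_loop ?G l" for l
  proof -
    obtain vs where vs: "distinct vs" "set vs \<subseteq> verts ?G" "2 \<le> length vs" "l = cycle_arcs vs"
      "\<And>u v. (u, v) \<in> l \<Longrightarrow> {u, v} \<in> edges ?G"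
      using directed_loopE[OF dl] by metis
    have cyc: "grid_cycle vs"
      using vs by (intro grid_cycle_if_arcs_edges[of vs m n a b z]) auto
    have dist: "distinct (cyclic_arcs vs)" using vs(1) by (rule distinct_zipI1)
    have "(\<Prod>(u, v)\<in>l. ?K u v) = (\<Prod>(u, v)\<in>l. orient u v * edge_weight ?G {u, v})"
    proof (intro prod.cong refl)
      fix e assume e: "e \<in> l"
      then have "grid_adj (fst e) (snd e)" using vs(5)[of "fst e" "snd e"] edge_grid_graph_iff by simp
      then have "fst e \<noteq> snd e" by (auto simp: grid_adj_def)
      then show "(case e of (u, v) \<Rightarrow> ?K u v)
          = (case e of (u, v) \<Rightarrow> orient u v * edge_weight ?G {u, v})"
        by (simp add: split_beta grid_kernel_def)
    qed
    also have "\<dots> = (\<Prod>(u, v)\<in>l. orient u v) * (\<Prod>(u, v)\<in>l. edge_weight ?G {u, v})"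
      unfolding split_beta by (rule prod.distrib)
    also have "(\<Prod>(u, v)\<in>l. orient u v) = orient_prod (cyclic_arcs vs)"
      unfolding vs(4) cycle_arcs_def by (rule prod.distinct_set_conv_list[OF dist])
    also have "\<dots> = - ((- 1) ^ card (odd_vertices ({1..m} \<times> {1..n}) vs))"
      using vs(2) by (intro orient_prod_grid_cycle[OF cyc]) simp
    finally show ?thesis
      unfolding loop_weight_def vs(4) num_enclosed_grid_cycle[OF cyc] by simp
  qed
  show "?K v v = vertex_weight ?G v" for v by (simp add: grid_kernel_def)
  show "?K u v = 0"
    if "u \<in> verts ?G" "v \<in> verts ?G" "u \<noteq> v" "{u, v} \<notin> edges ?G" for u v
    using that orient_eq_0[of u v] by (auto simp: grid_kernel_def edge_grid_graph_iff)
qed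

text \<open>Moves the Leibniz sum from the vertex set to matrix indices: transporting a permutation
  along the enumeration e preserves its sign.\<close>

lemma det_mat_reindex:
  fixes K :: "'v \<Rightarrow> 'v \<Rightarrow> 'a :: comm_ring_1"
  assumes e: "bij_betw e {0..<N} V"
  shows "Determinant.det (mat N N (\<lambda>(k, l). K (e k) (e l)))
    = (\<Sum>p | p permutes V. of_int (sign p) * (\<Prod>v\<in>V. K v (p v)))"
proof -
  let ?I = "{0..<N}"
  let ?h = "map_permutation ?I e"
  have inj: "inj_on e ?I" and img: "e ` ?I = V" using e unfolding bij_betw_def by auto
  have "bij_betw ?h {p. p permutes ?I} {p. p permutes V}"
    using bij_betw_permutations[OF e]
    unfolding map_permutation_def restrict_id_def img comp_def .
  then have "(\<Sum>p | p permutes V. of_int (sign p) * (\<Prod>v\<in>V. K v (p v)))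
    = (\<Sum>p | p permutes ?I. of_int (sign (?h p)) * (\<Prod>v\<in>V. K v (?h p v)))"
    by (rule sum.reindex_bij_betw[symmetric])
  also have "\<dots> = (\<Sum>p | p permutes ?I. of_int (sign p) * (\<Prod>k = 0..<N. K (e k) (e (p k))))"
  proof (intro sum.cong refl)
    fix p assume "p \<in> {p. p permutes ?I}"
    then have "sign (?h p) = sign p" by (intro sign_map_permutation inj) auto
    moreover have "(\<Prod>v\<in>V. K v (?h p v)) = (\<Prod>k\<in>?I. K (e k) (?h p (e k)))"
      by (rule prod.reindex_bij_betw[OF e, symmetric])
    ultimately show "of_int (sign (?h p)) * (\<Prod>v\<in>V. K v (?h p v))
        = of_int (sign p) * (\<Prod>k = 0..<N. K (e k) (e (p k)))"
      by (simp add: map_permutation_apply[OF inj] del: of_int_of_nat_eq)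
  qed
  also have "\<dots> = Determinant.det (mat N N (\<lambda>(k, l). K (e k) (e l)))"
    by (subst det_def'[of _ N]) (auto intro!: sum.cong prod.cong simp: permutes_in_image)
  finally show ?thesis ..
qed

text \<open>If the \<open>\<phi> q\<close> are pairwise orthogonal eigenvectors of \<open>K K\<^sup>T\<close>, the matrix \<open>S\<close> with these columns is
  invertible and \<open>K K\<^sup>T S = S D\<close> with \<open>D\<close> diagonal.\<close>

lemma determinant_square_eq_prod_eigenvalues:
  fixes K \<phi> :: "'v \<Rightarrow> 'v \<Rightarrow> real"
  assumes fin: "finite V"
    and eig: "\<And>p q. p \<in> V \<Longrightarrow> q \<in> V \<Longrightarrow>
      (\<Sum>r\<in>V. K p r * (\<Sum>s\<in>V. K s r * \<phi> q s)) = ev q * \<phi> q p"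
    and orth: "\<And>q q'. q \<in> V \<Longrightarrow> q' \<in> V \<Longrightarrow> q \<noteq> q' \<Longrightarrow> (\<Sum>p\<in>V. \<phi> q p * \<phi> q' p) = 0"
    and nonzero: "\<And>q. q \<in> V \<Longrightarrow> \<exists>p\<in>V. \<phi> q p \<noteq> 0"
  shows "(\<Sum>p | p permutes V. of_int (sign p) * (\<Prod>v\<in>V. K v (p v)))\<^sup>2 = (\<Prod>q\<in>V. ev q)"
proof -
  define N where "N = card V"
  obtain e where e: "bij_betw e {0..<N} V"
    using ex_bij_betw_nat_finite[OF fin] unfolding N_def by blast
  have eV: "e k \<in> V" if "k < N" for k using bij_betwE[OF e] that by auto
  have inj: "e k = e l \<longleftrightarrow> k = l" if "k < N" "l < N" for k l
    using bij_betw_imp_inj_on[OF e] that by (auto simp: inj_on_def)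
  have sum_e: "(\<Sum>k = 0..<N. g (e k)) = (\<Sum>v\<in>V. g v)" for g :: "'v \<Rightarrow> real"
    by (rule sum.reindex_bij_betw[OF e])
  define M where "M = mat N N (\<lambda>(k, l). K (e k) (e l))"
  define S where "S = mat N N (\<lambda>(k, l). \<phi> (e l) (e k))"
  define D where "D = mat N N (\<lambda>(k, l). if k = l then ev (e k) else 0)"
  have car: "M \<in> carrier_mat N N" "S \<in> carrier_mat N N" "D \<in> carrier_mat N N"
    unfolding M_def S_def D_def by auto
  have MTS: "(transpose_mat M * S) $$ (k, l) = (\<Sum>s\<in>V. K s (e k) * \<phi> (e l) s)"
    if "k < N" "l < N" for k l
    using that unfolding M_def S_def
    by (simp add: scalar_prod_def sum_e[of "\<lambda>s. K s (e k) * \<phi> (e l) s"])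
  have "M * (transpose_mat M * S) = S * D"
  proof (rule eq_matI)
    fix k l assume "k < dim_row (S * D)" "l < dim_col (S * D)"
    then have kl: "k < N" "l < N" using car by auto
    have "(M * (transpose_mat M * S)) $$ (k, l)
      = (\<Sum>r = 0..<N. K (e k) (e r) * (transpose_mat M * S) $$ (r, l))"
      using kl car by (simp add: scalar_prod_def) (simp add: M_def)
    also have "\<dots> = (\<Sum>r = 0..<N. K (e k) (e r) * (\<Sum>s\<in>V. K s (e r) * \<phi> (e l) s))"
      using kl MTS by (intro sum.cong) auto
    also have "\<dots> = ev (e l) * \<phi> (e l) (e k)"
      unfolding sum_e[of "\<lambda>r. K (e k) r * (\<Sum>s\<in>V. K s r * \<phi> (e l) s)"]
      using eig eV kl by simp
    also have "\<dots> = (\<Sum>r = 0..<N. if r = l then ev (e l) * \<phi> (e l) (e k) else 0)"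
      using kl by simp
    also have "\<dots> = (\<Sum>r = 0..<N. S $$ (k, r) * D $$ (r, l))"
      using kl by (intro sum.cong) (auto simp: S_def D_def)
    also have "\<dots> = (S * D) $$ (k, l)"
      using kl car by (simp add: scalar_prod_def)
    finally show "(M * (transpose_mat M * S)) $$ (k, l) = (S * D) $$ (k, l)" .
  qed (use car in auto)
  then have "Determinant.det (M * (transpose_mat M * S)) = Determinant.det (S * D)" by simp
  then have dets: "Determinant.det M * (Determinant.det M * Determinant.det S)
      = Determinant.det S * Determinant.det D"
    using car by (simp add: det_mult[of _ N] det_transpose[of _ N])
  have detD: "Determinant.det D = (\<Prod>q\<in>V. ev q)"
  proof -
    have "Determinant.det D = prod_list (diag_mat D)"
      by (rule det_upper_triangular[OF _ car(3)]) (auto simp: D_def)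
    also have "\<dots> = (\<Prod>k\<in>{0..<N}. ev (e k))"
      unfolding prod_list_diag_prod by (intro prod.cong) (auto simp: D_def)
    also have "\<dots> = (\<Prod>q\<in>V. ev q)" by (rule prod.reindex_bij_betw[OF e])
    finally show ?thesis .
  qed
  have StS: "(transpose_mat S * S) $$ (k, l) = (\<Sum>p\<in>V. \<phi> (e k) p * \<phi> (e l) p)"
    if "k < N" "l < N" for k l
    using that unfolding S_def
    by (simp add: scalar_prod_def sum_e[of "\<lambda>p. \<phi> (e k) p * \<phi> (e l) p"])
  \<comment> \<open>The Gram matrix of the eigenvectors is diagonal with positive entries, so S is
    invertible and its determinant cancels from \<open>dets\<close>.\<close>
  have "Determinant.det (transpose_mat S * S) = prod_list (diag_mat (transpose_mat S * S))"
  proof (rule det_upper_triangular)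
    show "upper_triangular (transpose_mat S * S)"
      using car StS orth eV inj by (intro upper_triangularI) auto
  qed (use car in auto)
  also have "\<dots> \<noteq> 0"
  proof -
    have "(\<Sum>p\<in>V. \<phi> (e k) p * \<phi> (e k) p) \<noteq> 0" if k: "k < N" for k
    proof -
      obtain p where "p \<in> V" "\<phi> (e k) p \<noteq> 0" using nonzero[OF eV[OF k]] by blast
      then have "0 < (\<Sum>p\<in>V. \<phi> (e k) p * \<phi> (e k) p)"
        by (intro sum_pos2[OF fin]) (auto simp: zero_less_mult_iff)
      then show ?thesis by simp
    qed
    then show ?thesis
      unfolding prod_list_diag_prod using car StS by (auto simp: prod_zero_iff)
  qed
  finally have "Determinant.det S \<noteq> 0"
    using car by (auto simp: det_mult[of _ N] det_transpose[of _ N])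
  with dets have "(Determinant.det M)\<^sup>2 = (\<Prod>q\<in>V. ev q)"
    unfolding detD by (simp add: power2_eq_square mult.assoc[symmetric]) 
  then show ?thesis
    unfolding M_def det_mat_reindex[OF e] .
qed

section \<open>Diagonalisation\<close>

text \<open>Sines satisfy a recurrence for f(x + 1) + f(x - 1), but the orientation matrix forms f(x
  + 1) - f(x - 1). The sign of \<open>x div 2\<close>, of period four, flips between x and x + 2 and
  so turns one into the other, at the price of a factor (-1)^x. The frequencies are those vanishing
  at 0 and m + 1.\<close>

definition twisted_sine :: "nat \<Rightarrow> nat \<Rightarrow> nat \<Rightarrow> real" where
  "twisted_sine m j x = (- 1) ^ (x div 2) * sin (pi * real j / real (m + 1) * real x)"

definition eigen_freq :: "nat \<Rightarrow> nat \<Rightarrow> real" where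
  "eigen_freq m j = 2 * cos (pi * real j / real (m + 1))"

definition grid_eigenvector :: "nat \<Rightarrow> nat \<Rightarrow> nat \<times> nat \<Rightarrow> nat \<times> nat \<Rightarrow> real" where
  "grid_eigenvector m n q p = twisted_sine m (fst q) (fst p) * twisted_sine n (snd q) (snd p)"

lemma twisted_sine_boundary [simp]: "twisted_sine m j 0 = 0" "twisted_sine m j (Suc m) = 0"
proof -
  have "pi * real j / real (m + 1) * real (Suc m) = real j * pi" by (simp add: field_simps)
  then show "twisted_sine m j (Suc m) = 0" unfolding twisted_sine_def by (simp only: sin_npi mult_zero_right)
qed (simp add: twisted_sine_def)

lemma twisted_sine_diff:
  "twisted_sine m j (Suc (Suc x)) - twisted_sine m j x
    = - ((- 1) ^ x * eigen_freq m j * twisted_sine m j (Suc x))"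
proof -
  define t where "t = pi * real j / real (m + 1)"
  have "sin (t * real (Suc (Suc x))) + sin (t * real x) = 2 * cos t * sin (t * real (Suc x))"
    using sin_plus_sin[of "t * real (Suc (Suc x))" "t * real x"]
    by (simp add: algebra_simps add_divide_distrib mult.commute)
  moreover have "(- 1 :: real) ^ x * (- 1) ^ (Suc x div 2) = (- 1) ^ (x div 2)"
    by (cases "even x") (auto elim!: evenE oddE)
  moreover have "twisted_sine m j (Suc (Suc x)) - twisted_sine m j x
      = - ((- 1) ^ (x div 2) * (sin (t * real (Suc (Suc x))) + sin (t * real x)))"
    unfolding twisted_sine_def t_def[symmetric] by (simp add: algebra_simps)
  ultimately have "twisted_sine m j (Suc (Suc x)) - twisted_sine m j x
      = - ((- 1) ^ x * (- 1) ^ (Suc x div 2) * (2 * cos t * sin (t * real (Suc x))))"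
    by (simp only:)
  then show ?thesis
    unfolding twisted_sine_def eigen_freq_def t_def[symmetric] by (simp only: mult_ac)
qed

text \<open>Since f vanishes on the surrounding frame, the sum may be extended to it, and then every
  vertex has all four neighbours. The minus sign before (-1)^x is the vertical sign of column x +
  1.\<close>

lemma sum_orient:
  fixes f :: "nat \<times> nat \<Rightarrow> real"
  assumes bd: "\<And>y. f (0, y) = 0" "\<And>y. f (Suc m, y) = 0" "\<And>x. f (x, 0) = 0" "\<And>x. f (x, Suc n) = 0"
    and x: "Suc x \<le> m" and y: "Suc y \<le> n"
  shows "(\<Sum>r\<in>{1..m} \<times> {1..n}. orient (Suc x, Suc y) r * f r)
    = f (Suc (Suc x), Suc y) - f (x, Suc y) - (- 1) ^ x * (f (Suc x, Suc (Suc y)) - f (Suc x, y))"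
proof -
  let ?p = "(Suc x, Suc y)"
  let ?N = "{(Suc (Suc x), Suc y), (x, Suc y), (Suc x, Suc (Suc y)), (Suc x, y)}"
  have "(\<Sum>r\<in>{1..m} \<times> {1..n}. orient ?p r * f r)
      = (\<Sum>r\<in>{0..Suc m} \<times> {0..Suc n}. orient ?p r * f r)"
  proof (rule sum.mono_neutral_left)
    show "\<forall>r\<in>{0..Suc m} \<times> {0..Suc n} - {1..m} \<times> {1..n}. orient ?p r * f r = 0"
    proof
      fix r assume "r \<in> {0..Suc m} \<times> {0..Suc n} - {1..m} \<times> {1..n}"
      then have "fst r = 0 \<or> fst r = Suc m \<or> snd r = 0 \<or> snd r = Suc n" by (cases r) auto
      then show "orient ?p r * f r = 0" using bd by (cases r) auto
    qed
  qed auto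
  also have "\<dots> = (\<Sum>r\<in>?N. orient ?p r * f r)"
  proof (rule sum.mono_neutral_right)
    show "\<forall>r\<in>{0..Suc m} \<times> {0..Suc n} - ?N. orient ?p r * f r = 0"
    proof
      fix r assume "r \<in> {0..Suc m} \<times> {0..Suc n} - ?N"
      then have "\<not> grid_adj ?p r" by (cases r) (auto simp: grid_adj_def)
      then show "orient ?p r * f r = 0" by (simp add: orient_eq_0)
    qed
  qed (use x y in auto)
  also have "\<dots> = f (Suc (Suc x), Suc y) - f (x, Suc y)
      - (- 1) ^ x * (f (Suc x, Suc (Suc y)) - f (Suc x, y))"
    by (simp add: orient_def algebra_simps)
  finally show ?thesis .
qed

lemma grid_vertexE:
  assumes "p \<in> {1..m} \<times> {1..n}"
  obtains x y where "p = (Suc x, Suc y)" "Suc x \<le> m" "Suc y \<le> n"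
  using assms that[of "fst p - 1" "snd p - 1"] by (cases p) auto

text \<open>The orientation matrix anticommutes its two directions, so its square acts on the eigenvector
  as minus the sum of the squared one-dimensional frequencies.\<close>

lemma orient_square_eigenvector:
  assumes p: "p \<in> {1..m} \<times> {1..n}"
  shows "(\<Sum>r\<in>{1..m} \<times> {1..n}. orient p r * (\<Sum>s\<in>{1..m} \<times> {1..n}. orient r s * grid_eigenvector m n q s))
    = - (((eigen_freq m (fst q))\<^sup>2 + (eigen_freq n (snd q))\<^sup>2) * grid_eigenvector m n q p)"
proof -
  let ?V = "{1..m} \<times> {1..n}"
  define a b s t where "a = eigen_freq m (fst q)" and "b = eigen_freq n (snd q)"
    and "s = twisted_sine m (fst q)" and "t = twisted_sine n (snd q)"
  have ev: "grid_eigenvector m n q = (\<lambda>p. s (fst p) * t (snd p))"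
    unfolding grid_eigenvector_def s_def t_def by auto
  have bd: "s 0 = 0" "s (Suc m) = 0" "t 0 = 0" "t (Suc n) = 0" unfolding s_def t_def by auto
  have ds: "s (Suc (Suc x)) - s x = - ((- 1) ^ x * a * s (Suc x))" for x
    unfolding s_def a_def by (rule twisted_sine_diff)
  have dt: "t (Suc (Suc y)) - t y = - ((- 1) ^ y * b * t (Suc y))" for y
    unfolding t_def b_def by (rule twisted_sine_diff)
  \<comment> \<open>The image of the vector after one application: not a multiple of it, but
    modulated by position-dependent signs. It again vanishes on the frame, so
    \<open>sum_orient\<close> applies a second time.\<close>
  define g where "g = (\<lambda>(x, y). (- 1) ^ x * s x * t y * (a + (- 1) ^ y * b))"
  have first: "(\<Sum>r\<in>?V. orient p r * (s (fst r) * t (snd r))) = g p" if p': "p \<in> ?V" for p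
  proof -
    obtain x y where xy: "p = (Suc x, Suc y)" "Suc x \<le> m" "Suc y \<le> n"
      by (rule grid_vertexE[OF p'])
    have "(\<Sum>r\<in>?V. orient p r * (s (fst r) * t (snd r)))
      = (s (Suc (Suc x)) - s x) * t (Suc y) - (- 1) ^ x * s (Suc x) * (t (Suc (Suc y)) - t y)"
      unfolding xy(1) using bd xy(2,3) by (subst sum_orient) (auto simp: algebra_simps)
    also have "\<dots> = g p" unfolding ds dt g_def xy(1) by (simp add: algebra_simps)
    finally show ?thesis .
  qed
  obtain x y where xy: "p = (Suc x, Suc y)" "Suc x \<le> m" "Suc y \<le> n"
    by (rule grid_vertexE[OF p])
  have "(\<Sum>r\<in>?V. orient p r * (\<Sum>s'\<in>?V. orient r s' * grid_eigenvector m n q s'))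
    = (\<Sum>r\<in>?V. orient p r * g r)"
    unfolding ev using first by (intro sum.cong) auto
  also have "\<dots> = g (Suc (Suc x), Suc y) - g (x, Suc y)
      - (- 1) ^ x * (g (Suc x, Suc (Suc y)) - g (Suc x, y))"
    unfolding xy(1) using bd xy(2,3) by (subst sum_orient) (auto simp: g_def)
  also have "\<dots> = (- 1) ^ x * (s (Suc (Suc x)) - s x) * t (Suc y) * (a - (- 1) ^ y * b)
      + s (Suc x) * (t (Suc (Suc y)) - t y) * (a + (- 1) ^ y * b)"
  proof -
    define u v :: real where "u = (- 1) ^ x" and "v = (- 1) ^ y"
    have uu: "u * u = 1" unfolding u_def by (simp flip: power_add mult_2)
    have g: "g (Suc (Suc x), Suc y) = u * s (Suc (Suc x)) * t (Suc y) * (a - v * b)"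
      "g (x, Suc y) = u * s x * t (Suc y) * (a - v * b)"
      "g (Suc x, Suc (Suc y)) = - (u * s (Suc x) * t (Suc (Suc y)) * (a + v * b))"
      "g (Suc x, y) = - (u * s (Suc x) * t y * (a + v * b))"
      unfolding g_def u_def v_def by simp_all
    have "u * s (Suc (Suc x)) * t (Suc y) * (a - v * b) - u * s x * t (Suc y) * (a - v * b)
        - u * (- (u * s (Suc x) * t (Suc (Suc y)) * (a + v * b)) - - (u * s (Suc x) * t y * (a + v * b)))
      = u * (s (Suc (Suc x)) - s x) * t (Suc y) * (a - v * b)
        + (u * u) * (s (Suc x) * (t (Suc (Suc y)) - t y) * (a + v * b))"
      by (simp add: algebra_simps)
    then show ?thesis unfolding u_def[symmetric] v_def[symmetric] g uu by simp
  qed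
  \<comment> \<open>The horizontal difference brings a (a - vb) and the vertical one vb (a + vb),
    where v = (-1)^y; the mixed terms cancel and v^2 = 1.\<close>
  also have "\<dots> = - ((a\<^sup>2 + b\<^sup>2) * (s (Suc x) * t (Suc y)))"
  proof -
    have sq: "(- 1) ^ k * ((- 1) ^ k * w) = w" for k and w :: real
      by (simp flip: power_add mult.assoc mult_2)
    show ?thesis unfolding ds dt
      by (simp add: algebra_simps power2_eq_square sq)
  qed
  finally show ?thesis unfolding ev xy(1) a_def b_def by simp
qed

text \<open>The signs square to 1, leaving ordinary sines. These solve the same second-order
  recurrence with different constants and vanish at both 0 and m + 1, so the discrete Green identity
  gives orthogonality; \<open>cos\<close> is injective on [0, pi], so the constants do
  differ.\<close>

lemma twisted_sine_orthogonal:
  assumes "j \<le> m" "j' \<le> m" "j \<noteq> j'"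
  shows "(\<Sum>x = 1..m. twisted_sine m j x * twisted_sine m j' x) = 0"
proof -
  define s t where "s x = sin (pi * real j / real (m + 1) * real x)"
    and "t x = sin (pi * real j' / real (m + 1) * real x)" for x
  define a b where "a = eigen_freq m j" and "b = eigen_freq m j'"
  have rec: "sin (c * real (Suc (Suc x))) + sin (c * real x) = 2 * cos c * sin (c * real (Suc x))"
    for c :: real and x
    using sin_plus_sin[of "c * real (Suc (Suc x))" "c * real x"]
    by (simp add: algebra_simps add_divide_distrib mult.commute)
  have rs: "s (Suc (Suc x)) + s x = a * s (Suc x)" and rt: "t (Suc (Suc x)) + t x = b * t (Suc x)" for x
    unfolding s_def t_def a_def b_def eigen_freq_def by (rule rec)+
  have bd: "s 0 = 0" "s (Suc m) = 0" "t 0 = 0" "t (Suc m) = 0"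
  proof -
    have "pi * real k / real (m + 1) * real (Suc m) = real k * pi" for k by (simp add: field_simps)
    then show "s (Suc m) = 0" "t (Suc m) = 0" unfolding s_def t_def by (simp_all only: sin_npi)
  qed (auto simp: s_def t_def)
  \<comment> \<open>the Wronskian of two solutions telescopes\<close>
  have "(a - b) * (\<Sum>x<k. s (Suc x) * t (Suc x)) = s (Suc k) * t k - s k * t (Suc k)" for k
  proof (induction k)
    case (Suc k)
    have "(a - b) * (\<Sum>x<Suc k. s (Suc x) * t (Suc x))
      = s (Suc k) * t k - s k * t (Suc k) + (a * s (Suc k)) * t (Suc k) - s (Suc k) * (b * t (Suc k))"
      using Suc by (simp add: algebra_simps)
    also have "\<dots> = s (Suc (Suc k)) * t (Suc k) - s (Suc k) * t (Suc (Suc k))"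
      unfolding rs[symmetric] rt[symmetric] by (simp add: algebra_simps)
    finally show ?case .
  qed (simp add: bd)
  from this[of m] have "(a - b) * (\<Sum>x = 1..m. s x * t x) = 0"
    using bd by (simp add: sum.atLeast1_atMost_eq)
  moreover have "a \<noteq> b"
  proof
    assume "a = b"
    then have cos_eq: "cos (pi * real j / real (m + 1)) = cos (pi * real j' / real (m + 1))"
      unfolding a_def b_def eigen_freq_def by simp
    have angle: "0 \<le> pi * real k / real (m + 1)" "pi * real k / real (m + 1) \<le> pi" if "k \<le> m" for k
    proof -
      have "pi * real k \<le> pi * real (m + 1)" using that by (intro mult_left_mono) auto
      then show "pi * real k / real (m + 1) \<le> pi" by (simp add: divide_le_eq)
    qed simp
    have "pi * real j / real (m + 1) = pi * real j' / real (m + 1)"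
      by (rule cos_inj_pi[OF angle[OF assms(1)] angle[OF assms(2)] cos_eq])
    then show False using assms(3) by simp
  qed
  moreover have "twisted_sine m j x * twisted_sine m j' x = s x * t x" for x
    unfolding twisted_sine_def s_def t_def by (cases "even (x div 2)") auto
  ultimately show ?thesis by simp
qed

lemma grid_eigenvector_orthogonal:
  assumes "q \<in> {1..m} \<times> {1..n}" "q' \<in> {1..m} \<times> {1..n}" "q \<noteq> q'"
  shows "(\<Sum>p\<in>{1..m} \<times> {1..n}. grid_eigenvector m n q p * grid_eigenvector m n q' p) = 0"
proof -
  have "(\<Sum>p\<in>{1..m} \<times> {1..n}. grid_eigenvector m n q p * grid_eigenvector m n q' p)
    = (\<Sum>x = 1..m. twisted_sine m (fst q) x * twisted_sine m (fst q') x)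
      * (\<Sum>y = 1..n. twisted_sine n (snd q) y * twisted_sine n (snd q') y)"
    unfolding sum_product sum.cartesian_product grid_eigenvector_def
    by (intro sum.cong) (auto simp: algebra_simps)
  moreover have "fst q \<noteq> fst q' \<or> snd q \<noteq> snd q'" using assms(3) by (auto simp: prod_eq_iff)
  ultimately show ?thesis using twisted_sine_orthogonal assms(1,2) by auto
qed

lemma twisted_sine_1_nonzero: "j \<in> {1..m} \<Longrightarrow> twisted_sine m j 1 \<noteq> 0"
proof -
  assume "j \<in> {1..m}"
  then have "0 < sin (pi * real j / real (m + 1))"
    by (intro sin_gt_zero) (auto simp: divide_less_eq)
  then show ?thesis by (simp add: twisted_sine_def)
qed

text \<open>With K = zI + A the transpose is zI - A, so the terms linear in z drop out of K K^T, and
  \<open>orient_square_eigenvector\<close> evaluates the rest.\<close>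

theorem grid_partition_function_square:
  "(grid_partition_function m n 1 1 z)\<^sup>2
    = (\<Prod>q\<in>{1..m} \<times> {1..n}. z\<^sup>2 + (eigen_freq m (fst q))\<^sup>2 + (eigen_freq n (snd q))\<^sup>2)"
proof -
  let ?V = "{1..m} \<times> {1..n}" and ?K = "grid_kernel m n 1 1 z"
  have K: "?K p r = z * of_bool (p = r) + orient p r" for p r
    using orient_eq_0[of p p] by (auto simp: grid_kernel_def grid_graph_def grid_adj_def)
  have diag: "(\<Sum>r\<in>?V. z * of_bool (p = r) * f r) = z * f p" if "p \<in> ?V" for p and f :: "nat \<times> nat \<Rightarrow> real"
  proof -
    have "(\<Sum>r\<in>?V. z * of_bool (p = r) * f r) = (\<Sum>r\<in>?V. if r = p then z * f p else 0)"
      by (intro sum.cong) auto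
    also have "\<dots> = z * f p" using that by (subst sum.delta) auto
    finally show ?thesis .
  qed
  have "(\<Sum>p | p permutes ?V. of_int (sign p) * (\<Prod>v\<in>?V. ?K v (p v)))\<^sup>2
    = (\<Prod>q\<in>?V. z\<^sup>2 + (eigen_freq m (fst q))\<^sup>2 + (eigen_freq n (snd q))\<^sup>2)"
  proof (rule determinant_square_eq_prod_eigenvalues[where \<phi> = "grid_eigenvector m n"])
    fix p q assume p: "p \<in> ?V" and q: "q \<in> ?V"
    let ?f = "grid_eigenvector m n q"
    let ?g = "\<lambda>r. \<Sum>s\<in>?V. orient r s * ?f s"
    have "(\<Sum>r\<in>?V. ?K p r * (\<Sum>s\<in>?V. ?K s r * ?f s)) = (\<Sum>r\<in>?V. ?K p r * (z * ?f r - ?g r))"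
    proof (intro sum.cong refl)
      fix r assume r: "r \<in> ?V"
      have "(\<Sum>s\<in>?V. ?K s r * ?f s) = (\<Sum>s\<in>?V. z * of_bool (r = s) * ?f s - orient r s * ?f s)"
        unfolding K by (intro sum.cong refl) (auto simp: orient_skew[of _ r] algebra_simps)
      also have "\<dots> = z * ?f r - ?g r" unfolding sum_subtractf diag[OF r] ..
      finally show "?K p r * (\<Sum>s\<in>?V. ?K s r * ?f s) = ?K p r * (z * ?f r - ?g r)" by simp
    qed
    also have "\<dots> = (\<Sum>r\<in>?V. z * of_bool (p = r) * (z * ?f r - ?g r)
        + (z * (orient p r * ?f r) - orient p r * ?g r))"
      unfolding K by (intro sum.cong refl) (simp add: algebra_simps)
    also have "\<dots> = z * (z * ?f p - ?g p) + (z * ?g p - (\<Sum>r\<in>?V. orient p r * ?g r))"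
      unfolding sum.distrib diag[OF p] sum_subtractf sum_distrib_left[symmetric] ..
    also have "\<dots> = (z\<^sup>2 + (eigen_freq m (fst q))\<^sup>2 + (eigen_freq n (snd q))\<^sup>2) * ?f p"
      unfolding orient_square_eigenvector[OF p] by (simp add: algebra_simps power2_eq_square)
    finally show "(\<Sum>r\<in>?V. ?K p r * (\<Sum>s\<in>?V. ?K s r * ?f s))
      = (z\<^sup>2 + (eigen_freq m (fst q))\<^sup>2 + (eigen_freq n (snd q))\<^sup>2) * ?f p" .
  next
    fix q assume q: "q \<in> ?V"
    then have "grid_eigenvector m n q (1, 1) \<noteq> 0"
      using twisted_sine_1_nonzero unfolding grid_eigenvector_def by auto
    moreover have "(1, 1) \<in> ?V" using q by auto
    ultimately show "\<exists>p\<in>?V. grid_eigenvector m n q p \<noteq> 0" by blast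
  next
    fix q q' assume "q \<in> ?V" "q' \<in> ?V" "q \<noteq> q'"
    then show "(\<Sum>p\<in>?V. grid_eigenvector m n q p * grid_eigenvector m n q' p) = 0"
      by (rule grid_eigenvector_orthogonal)
  qed simp
  then show ?thesis
    unfolding grid_partition_function_def grid.partition_function_eq_determinant by simp
qed

section \<open>Elliptic integrals\<close>

lemma integral_periodic_shift:
  fixes f :: "real \<Rightarrow> real"
  assumes cont: "continuous_on UNIV f" and per: "\<And>x. f (x + T) = f x" and c: "0 \<le> c" "c \<le> T"
  shows "integral {0..T} (\<lambda>x. f (x + c)) = integral {0..T} f"
proof -
  have int: "f integrable_on {a..b}" for a b
    by (intro integrable_continuous_real continuous_on_subset[OF cont]) auto
  have "integral {0..T} (\<lambda>x. f (x + c)) = integral {c..T + c} f"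
    using integral_shift_real_ivl[where a = c and b = "T + c" and c = c and f = f] by simp
  also have "\<dots> = integral {c..T} f + integral {T..T + c} f"
    using c by (intro Henstock_Kurzweil_Integration.integral_combine[symmetric] int) auto
  also have "integral {T..T + c} f = integral {0..c} f"
    using integral_shift_real_ivl[where a = T and b = "T + c" and c = T and f = f] per by simp
  also have "integral {c..T} f + integral {0..c} f = integral {0..T} f"
    using Henstock_Kurzweil_Integration.integral_combine[OF c int] by simp
  finally show ?thesis .
qed

lemma integral_double:
  fixes f :: "real \<Rightarrow> real"
  shows "integral {0..2 * T} f = 2 * integral {0..T} (\<lambda>x. f (2 * x))"
proof (cases "0 \<le> T")
  case True
  have "(\<lambda>x. x / 2) ` {0..2 * T} = {0..T}"
    using True by (subst image_divide_atLeastAtMost) auto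
  then show ?thesis using integral_stretch_real[of 2 0 "2 * T" f] by simp
qed simp

text \<open>By the subtraction formula, tan (t - arctan (k tan t)) = (1 - k) tan t / (1 + k (tan
  t)^2); clearing cos^2 gives the quotient in the antiderivative. It vanishes at 0 and pi, so the
  antiderivative grows by exactly pi.\<close>

lemma integral_inverse_cos2_sin2:
  fixes k :: real
  assumes k: "k > 0"
  shows "integral {0..pi} (\<lambda>t. k / ((cos t)\<^sup>2 + k\<^sup>2 * (sin t)\<^sup>2)) = pi"
proof -
  \<comment> \<open>a branch of \<open>arctan (k * tan t)\<close> that is smooth across the poles of \<open>tan\<close>\<close>
  define A where "A t = t - arctan ((1 - k) * (sin t * cos t) / ((cos t)\<^sup>2 + k * (sin t)\<^sup>2))" for t
  have pos: "0 < (cos t)\<^sup>2 + c * (sin t)\<^sup>2" if "c > 0" for c t :: real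
  proof (cases "sin t = 0")
    case True
    then show ?thesis using sin_cos_squared_add[of t] by simp
  next
    case False
    then show ?thesis using that by (intro add_nonneg_pos) auto
  qed
  have "(A has_real_derivative k / ((cos t)\<^sup>2 + k\<^sup>2 * (sin t)\<^sup>2)) (at t)" for t
  proof -
    define S C where "S = sin t" and "C = cos t"
    have SC: "S\<^sup>2 + C\<^sup>2 = 1" unfolding S_def C_def by simp
    define N D where "N = (1 - k) * (S * C)" and "D = C\<^sup>2 + k * S\<^sup>2"
    have D: "D > 0" unfolding D_def S_def C_def using pos[OF k] .
    have E: "C\<^sup>2 + k\<^sup>2 * S\<^sup>2 > 0" unfolding S_def C_def using pos[of "k\<^sup>2"] k by simp
    have ND: "N\<^sup>2 + D\<^sup>2 = C\<^sup>2 + k\<^sup>2 * S\<^sup>2"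
    proof -
      have "N\<^sup>2 + D\<^sup>2 = (S\<^sup>2 + C\<^sup>2) * (C\<^sup>2 + k\<^sup>2 * S\<^sup>2)"
        unfolding N_def D_def by (simp add: power2_eq_square algebra_simps)
      then show ?thesis using SC by simp
    qed
    define N' D' where "N' = (1 - k) * (C * C - S * S)" and "D' = 2 * (k - 1) * (S * C)"
    have dN: "((\<lambda>t. (1 - k) * (sin t * cos t)) has_real_derivative N') (at t)"
      unfolding N'_def S_def C_def by (auto intro!: derivative_eq_intros)
    have dD: "((\<lambda>t. (cos t)\<^sup>2 + k * (sin t)\<^sup>2) has_real_derivative D') (at t)"
      unfolding D'_def S_def C_def by (auto intro!: derivative_eq_intros simp: algebra_simps)
    have "((\<lambda>t. (1 - k) * (sin t * cos t) / ((cos t)\<^sup>2 + k * (sin t)\<^sup>2))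
        has_real_derivative (N' * D - N * D') / (D * D)) (at t)"
      using DERIV_divide[OF dN dD] D unfolding N_def D_def S_def C_def by simp
    from DERIV_diff[OF DERIV_ident DERIV_chain2[OF DERIV_arctan this]]
    have "(A has_real_derivative
        1 - inverse (1 + (N / D)\<^sup>2) * ((N' * D - N * D') / (D * D))) (at t)"
      unfolding A_def[abs_def] N_def D_def S_def C_def .
    moreover have "1 - inverse (1 + (N / D)\<^sup>2) * ((N' * D - N * D') / (D * D)) = k / (C\<^sup>2 + k\<^sup>2 * S\<^sup>2)"
    proof -
      have "1 + (N / D)\<^sup>2 = (N\<^sup>2 + D\<^sup>2) / (D * D)"
        using D by (simp add: power2_eq_square field_simps)
      then have "inverse (1 + (N / D)\<^sup>2) * ((N' * D - N * D') / (D * D))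
          = (N' * D - N * D') / (C\<^sup>2 + k\<^sup>2 * S\<^sup>2)"
      proof -
        have "inverse (e / d) * (X / d) = X / e" if "d \<noteq> 0" for e d X :: real
          using that by (simp add: inverse_eq_divide)
        from this[of "D * D"] show ?thesis
          using D unfolding \<open>1 + (N / D)\<^sup>2 = (N\<^sup>2 + D\<^sup>2) / (D * D)\<close> ND by simp
      qed
      moreover have "N' * D - N * D' = (1 - k) * (S\<^sup>2 + C\<^sup>2) * (C\<^sup>2 - k * S\<^sup>2)"
        unfolding N_def D_def N'_def D'_def by (simp add: power2_eq_square algebra_simps)
      moreover have "1 - (1 - k) * (C\<^sup>2 - k * S\<^sup>2) / (C\<^sup>2 + k\<^sup>2 * S\<^sup>2)
          = k * (S\<^sup>2 + C\<^sup>2) / (C\<^sup>2 + k\<^sup>2 * S\<^sup>2)"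
        using E by (simp add: field_simps power2_eq_square)
      ultimately show ?thesis unfolding SC by simp
    qed
    ultimately show ?thesis unfolding S_def C_def by simp
  qed
  then have "((\<lambda>t. k / ((cos t)\<^sup>2 + k\<^sup>2 * (sin t)\<^sup>2)) has_integral A pi - A 0) {0..pi}"
    by (intro fundamental_theorem_of_calculus)
      (auto simp: has_real_derivative_iff_has_vector_derivative[symmetric]
        intro: has_field_derivative_at_within)
  then show ?thesis by (simp add: integral_unique A_def)
qed

text \<open>With p = s + c and q = s - c the denominator is p (cos t)^2 + q (sin t)^2, so k^2 = q /
  p reduces it to the previous integral, and p k = sqrt (p q).\<close>

lemma integral_inverse_linear_cos:
  fixes s c :: real
  assumes "\<bar>c\<bar> < s"
  shows "integral {0..pi} (\<lambda>t. 1 / (s + c * cos (2 * t))) = pi / sqrt (s\<^sup>2 - c\<^sup>2)"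
proof -
  define p q where "p = s + c" and "q = s - c"
  have pq: "p > 0" "q > 0" using assms unfolding p_def q_def by auto
  define k where "k = sqrt (q / p)"
  have k: "k > 0" "k\<^sup>2 = q / p" unfolding k_def using pq by auto
  have pk: "p * k = sqrt (s\<^sup>2 - c\<^sup>2)"
  proof -
    have "p * k = sqrt (p\<^sup>2) * sqrt (q / p)" unfolding k_def using pq by simp
    also have "\<dots> = sqrt (p\<^sup>2 * (q / p))" by (rule real_sqrt_mult[symmetric])
    also have "p\<^sup>2 * (q / p) = s\<^sup>2 - c\<^sup>2"
      using pq(1) by (simp add: power2_eq_square) (simp add: p_def q_def algebra_simps)
    finally show ?thesis .
  qed
  have "1 / (s + c * cos (2 * t)) = 1 / (p * k) * (k / ((cos t)\<^sup>2 + k\<^sup>2 * (sin t)\<^sup>2))" for t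
  proof -
    have "s + c * cos (2 * t) = s * ((sin t)\<^sup>2 + (cos t)\<^sup>2) + c * ((cos t)\<^sup>2 - (sin t)\<^sup>2)"
      by (simp add: cos_double)
    also have "\<dots> = p * ((cos t)\<^sup>2 + k\<^sup>2 * (sin t)\<^sup>2)"
    proof -
      have "p * ((cos t)\<^sup>2 + k\<^sup>2 * (sin t)\<^sup>2) = p * (cos t)\<^sup>2 + q * (sin t)\<^sup>2"
        unfolding k(2) using pq(1) by (simp add: distrib_left)
      moreover have "s * (x + y) + c * (y - x) = p * y + q * x" for x y
        unfolding p_def q_def by (simp add: algebra_simps)
      ultimately show ?thesis by metis
    qed
    finally show ?thesis using k(1) by simp
  qed
  then have "integral {0..pi} (\<lambda>t. 1 / (s + c * cos (2 * t))) = 1 / (p * k) * pi"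
    using integral_inverse_cos2_sin2[OF k(1)] by (simp only: integral_mult_right)
  then show ?thesis unfolding pk by simp
qed

text \<open>The double angle sweeps [0, pi], both halves of which contribute equally, so the factor
  1/2 of the substitution is undone. A shift and a reflection exchange cos^2 for sin^2.\<close>

lemma integral_inverse_sqrt_cos:
  fixes k :: real
  assumes k: "\<bar>k\<bar> < 1"
  shows "integral {0..pi / 2} (\<lambda>t. 1 / sqrt (1 - k\<^sup>2 * (cos (2 * t))\<^sup>2)) = complete_elliptic_K k"
proof -
  define g where "g x = 1 / sqrt (1 - k\<^sup>2 * x\<^sup>2)" for x :: real
  have pos: "0 < 1 - k\<^sup>2 * x\<^sup>2" if "\<bar>x\<bar> \<le> 1" for x :: real
  proof -
    have "k\<^sup>2 * x\<^sup>2 \<le> k\<^sup>2 * 1" using that by (intro mult_left_mono) (auto simp: abs_square_le_1)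
    also have "\<dots> < 1" using k by (simp add: abs_square_less_1)
    finally show ?thesis by simp
  qed
  have cont: "continuous_on UNIV (\<lambda>t. g (cos t))" "continuous_on UNIV (\<lambda>t. g (sin t))"
  proof -
    have "1 - k\<^sup>2 * (cos t)\<^sup>2 \<noteq> 0" "1 - k\<^sup>2 * (sin t)\<^sup>2 \<noteq> 0" for t
      using pos[OF abs_cos_le_one[of t]] pos[OF abs_sin_le_one[of t]] by simp_all
    then show "continuous_on UNIV (\<lambda>t. g (cos t))" "continuous_on UNIV (\<lambda>t. g (sin t))"
      unfolding g_def by (auto intro!: continuous_intros)
  qed
  have int: "(\<lambda>t. g (cos t)) integrable_on {a..b}" "(\<lambda>t. g (sin t)) integrable_on {a..b}" for a b
    by (intro integrable_continuous_real continuous_on_subset[OF cont(1)] continuous_on_subset[OF cont(2)]; simp)+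
  have "2 * integral {0..pi / 2} (\<lambda>t. g (cos (2 * t))) = integral {0..pi} (\<lambda>t. g (cos t))"
    using integral_double[of "pi / 2" "\<lambda>t. g (cos t)"] by simp
  also have "\<dots> = integral {0..pi / 2} (\<lambda>t. g (cos t)) + integral {pi / 2..pi} (\<lambda>t. g (cos t))"
    by (intro Henstock_Kurzweil_Integration.integral_combine[symmetric] int) auto
  also have "integral {pi / 2..pi} (\<lambda>t. g (cos t)) = integral {0..pi / 2} (\<lambda>t. g (sin t))"
    using integral_shift_real_ivl[where a = "pi / 2" and b = pi and c = "pi / 2" and f = "\<lambda>t. g (cos t)"]
    by (simp add: cos_add g_def)
  also have "integral {0..pi / 2} (\<lambda>t. g (cos t)) = integral {0..pi / 2} (\<lambda>t. g (sin t))"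
  proof -
    have "integral {0..pi / 2} (\<lambda>t. g (cos t)) = integral {- (pi / 2)..0} (\<lambda>t. g (cos (- t)))"
      using Henstock_Kurzweil_Integration.integral_reflect_real
          [where a = 0 and b = "pi / 2" and f = "\<lambda>t. g (cos t)"]
      by (simp only: minus_zero)
    also have "\<dots> = integral {0..pi / 2} (\<lambda>t. g (cos (- (t - pi / 2))))"
      using integral_shift_real_ivl[where a = "- (pi / 2)" and b = 0 and c = "- (pi / 2)" and f = "\<lambda>t. g (cos (- t))"] by simp
    also have "\<dots> = integral {0..pi / 2} (\<lambda>t. g (sin t))" by (simp add: cos_diff)
    finally show ?thesis .
  qed
  finally have "integral {0..pi / 2} (\<lambda>t. g (cos (2 * t))) = integral {0..pi / 2} (\<lambda>t. g (sin t))"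
    by simp
  then show ?thesis unfolding g_def complete_elliptic_K_def .
qed

text \<open>Substituting \<open>x = \<alpha> + \<beta>\<close> and \<open>y = \<alpha> - \<beta>\<close> turns \<open>cos 2x + cos 2y\<close> into the product
  \<open>2 cos 2\<alpha> cos 2\<beta>\<close>, after which the inner integral is elementary.\<close>

lemma integral_lattice_green:
  fixes s :: real
  assumes s: "s > 4"
  shows "integral {0..pi} (\<lambda>x. integral {0..pi} (\<lambda>y. 1 / (s + 2 * cos (2 * x) + 2 * cos (2 * y))))
    = 2 * pi / s * complete_elliptic_K (4 / s)"
proof -
  define H where "H x y = 1 / (s + 2 * cos (2 * x) + 2 * cos (2 * y))" for x y :: real
  have den: "s + 2 * cos (2 * x) + 2 * cos (2 * y) \<noteq> 0" for x y
    using s cos_ge_minus_one[of "2 * x"] cos_ge_minus_one[of "2 * y"] by linarith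
  have H_cont: "continuous_on A (\<lambda>p. H (f p) (g p))"
    if "continuous_on A f" "continuous_on A g" for A :: "'a :: t2_space set" and f g
    unfolding H_def by (intro continuous_intros that ballI den)
  have per: "H (x + pi) y = H x y" "H x (y + pi) = H x y" for x y
    unfolding H_def by (simp_all add: distrib_left)
  have swap: "integral {0..a} (\<lambda>x. integral {0..b} (\<lambda>y. H (f x y) (g x y)))
      = integral {0..b} (\<lambda>y. integral {0..a} (\<lambda>x. H (f x y) (g x y)))"
    if "continuous_on UNIV (\<lambda>p. f (fst p) (snd p))" "continuous_on UNIV (\<lambda>p. g (fst p) (snd p))"
    for a b :: real and f g
  proof -
    have "continuous_on (cbox (0, 0) (a, b)) (\<lambda>(x, y). H (f x y) (g x y))"
      unfolding split_beta
      by (intro H_cont continuous_on_subset[OF that(1)] continuous_on_subset[OF that(2)] subset_UNIV)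
    from integral_swap_continuous[OF this] show ?thesis unfolding box_real .
  qed
  have "integral {0..pi} (\<lambda>x. integral {0..pi} (\<lambda>y. H x y))
      = integral {0..pi} (\<lambda>y. integral {0..pi} (\<lambda>x. H x y))"
    by (rule swap) (intro continuous_intros)+
  \<comment> \<open>The rotation is carried out by one-dimensional shifts along the period instead
    of a planar substitution: first x becomes x + y, then x = 2b, and after exchanging the integrals
    y becomes a - b.\<close>
  also have "\<dots> = integral {0..pi} (\<lambda>y. integral {0..pi} (\<lambda>x. H (x + y) y))"
    by (intro integral_cong integral_periodic_shift[symmetric] H_cont continuous_intros)
      (auto simp: per)
  also have "\<dots> = integral {0..pi} (\<lambda>y. 2 * integral {0..pi / 2} (\<lambda>b. H (2 * b + y) y))"
    using integral_double[of "pi / 2" "\<lambda>x. H (x + y) y" for y] by simp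
  also have "\<dots> = 2 * integral {0..pi} (\<lambda>y. integral {0..pi / 2} (\<lambda>b. H (2 * b + y) y))"
    by simp
  also have "integral {0..pi} (\<lambda>y. integral {0..pi / 2} (\<lambda>b. H (2 * b + y) y))
      = integral {0..pi / 2} (\<lambda>b. integral {0..pi} (\<lambda>y. H (2 * b + y) y))"
    by (rule swap) (intro continuous_intros)+
  also have "\<dots> = integral {0..pi / 2} (\<lambda>b. pi / s * (1 / sqrt (1 - (4 / s)\<^sup>2 * (cos (2 * b))\<^sup>2)))"
  proof (rule integral_cong)
    fix b assume "b \<in> {0..pi / 2}"
    \<comment> \<open>The shift by -b is replaced by pi - b, the same modulo the period and within
      the range of \<open>integral_periodic_shift\<close>.\<close>
    then have b: "0 \<le> pi - b" "pi - b \<le> pi" by auto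
    have "integral {0..pi} (\<lambda>y. H (2 * b + y) y)
        = integral {0..pi} (\<lambda>y. H (2 * b + (y + (pi - b))) (y + (pi - b)))"
      using b per(1)[of "2 * b + _"]
      by (intro integral_periodic_shift[symmetric] H_cont continuous_intros)
        (auto simp: per add.assoc[symmetric])
    also have "\<dots> = integral {0..pi} (\<lambda>a. 1 / (s + 4 * cos (2 * b) * cos (2 * a)))"
    proof (rule integral_cong)
      fix a :: real
      have "H (2 * b + (a + (pi - b))) (a + (pi - b)) = H (a + b) (a - b)"
        using per(1)[of "a + b"] per(2)[of _ "a - b"] by (simp add: algebra_simps)
      also have "2 * cos (2 * (a + b)) + 2 * cos (2 * (a - b)) = 4 * cos (2 * b) * cos (2 * a)"
        by (simp add: distrib_left right_diff_distrib cos_add cos_diff)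
      then have "H (a + b) (a - b) = 1 / (s + 4 * cos (2 * b) * cos (2 * a))"
        unfolding H_def by (simp add: add.assoc)
      finally show "H (2 * b + (a + (pi - b))) (a + (pi - b)) = 1 / (s + 4 * cos (2 * b) * cos (2 * a))" .
    qed
    also have "\<dots> = pi / sqrt (s\<^sup>2 - (4 * cos (2 * b))\<^sup>2)"
    proof (rule integral_inverse_linear_cos)
      show "\<bar>4 * cos (2 * b)\<bar> < s" using s abs_cos_le_one[of "2 * b"] unfolding abs_mult by linarith
    qed
    also have "s\<^sup>2 - (4 * cos (2 * b))\<^sup>2 = s\<^sup>2 * (1 - (4 / s)\<^sup>2 * (cos (2 * b))\<^sup>2)"
      using s by (simp add: field_simps power2_eq_square)
    also have "pi / sqrt \<dots> = pi / s * (1 / sqrt (1 - (4 / s)\<^sup>2 * (cos (2 * b))\<^sup>2))"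
      using s by (simp add: real_sqrt_mult)
    finally show "integral {0..pi} (\<lambda>y. H (2 * b + y) y)
      = pi / s * (1 / sqrt (1 - (4 / s)\<^sup>2 * (cos (2 * b))\<^sup>2))" .
  qed
  also have "\<dots> = pi / s * complete_elliptic_K (4 / s)"
    using integral_inverse_sqrt_cos[of "4 / s"] s by (simp only: integral_mult_right) simp
  finally show ?thesis unfolding H_def by simp
qed

section \<open>The free energy\<close>

text \<open>Each of the m + 1 cells of width h = T / (m + 1) has error at most C h^2, which after
  division by h adds up to C T. The summand B pays for the node 0, absent from the sum.\<close>

lemma riemann_sum_lipschitz:
  fixes g :: "real \<Rightarrow> real"
  assumes T: "T > 0" and C: "C \<ge> 0"
    and lip: "\<And>x y. \<bar>g x - g y\<bar> \<le> C * \<bar>x - y\<bar>" and bd: "\<And>x. \<bar>g x\<bar> \<le> B"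
  shows "\<bar>(\<Sum>j = 1..m. g (T * real j / real (m + 1))) - real (m + 1) / T * integral {0..T} g\<bar>
    \<le> C * T + B"
proof -
  define h where "h = T / real (m + 1)"
  have h: "h > 0" "real (m + 1) * h = T" unfolding h_def using T by auto
  have cont: "continuous_on A g" for A
    using C lip by (intro lipschitz_on_continuous_on[of C] lipschitz_onI) (auto simp: dist_real_def)
  have int: "g integrable_on {a..b}" for a b by (intro integrable_continuous_real cont)
  have step: "\<bar>integral {a..a + h} g - h * g a\<bar> \<le> C * h * h" for a
  proof -
    have "integral {a..a + h} g - h * g a = integral {a..a + h} (\<lambda>x. g x - g a)"
      using h(1) by (subst integral_diff) (auto intro: int)
    also have "\<bar>\<dots>\<bar> \<le> C * h * ((a + h) - a)"
      unfolding real_norm_def[symmetric]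
    proof (rule integral_bound)
      fix t assume "t \<in> {a..a + h}"
      then have "C * \<bar>t - a\<bar> \<le> C * h" using C by (intro mult_left_mono) auto
      then show "norm (g t - g a) \<le> C * h" using lip[of t a] by simp
    qed (use h(1) in \<open>auto intro!: continuous_intros cont\<close>)
    finally show ?thesis by simp
  qed
  have sums: "\<bar>integral {0..real k * h} g - h * (\<Sum>j<k. g (real j * h))\<bar> \<le> real k * (C * h * h)" for k
  proof (induction k)
    case (Suc k)
    have "integral {0..real (Suc k) * h} g
        = integral {0..real k * h} g + integral {real k * h..real k * h + h} g"
      using h(1) Henstock_Kurzweil_Integration.integral_combine
          [of 0 "real k * h" "real (Suc k) * h" g] int
      by (simp add: algebra_simps)
    then show ?case using Suc step[of "real k * h"] by (simp add: algebra_simps)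
  qed simp
  let ?S = "\<Sum>j<m + 1. g (real j * h)"
  have "\<bar>integral {0..T} g - h * ?S\<bar> \<le> T * C * h"
    using sums[of "m + 1"] unfolding h(2) mult.assoc[symmetric] by (simp add: mult_ac h(2)[symmetric])
  then have "\<bar>integral {0..T} g - h * ?S\<bar> / h \<le> C * T"
    using h(1) by (simp add: divide_le_eq mult_ac)
  moreover have "\<bar>integral {0..T} g - h * ?S\<bar> / h = \<bar>?S - real (m + 1) / T * integral {0..T} g\<bar>"
  proof -
    have "\<bar>integral {0..T} g - h * ?S\<bar> / h = \<bar>(integral {0..T} g - h * ?S) / h\<bar>" using h(1) by simp
    also have "(integral {0..T} g - h * ?S) / h = real (m + 1) / T * integral {0..T} g - ?S"
      using h(1) T by (simp add: diff_divide_distrib) (simp add: h_def)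
    finally show ?thesis by (simp add: abs_minus_commute)
  qed
  ultimately have main: "\<bar>?S - real (m + 1) / T * integral {0..T} g\<bar> \<le> C * T" by simp
  have "?S = g 0 + (\<Sum>j = 1..m. g (T * real j / real (m + 1)))"
  proof -
    have "?S = g (real 0 * h) + (\<Sum>j<m. g (real (Suc j) * h))"
      unfolding Suc_eq_plus1[symmetric] by (rule sum.lessThan_Suc_shift)
    then show ?thesis by (simp add: sum.atLeast1_atMost_eq h_def mult_ac)
  qed
  then show ?thesis using main bd[of 0] by linarith
qed

text \<open>The one-dimensional bound is used in y at each of the m nodes, and in x for the inner
  integral, which has Lipschitz constant C T and bound B T; weighted by (n + 1) / T, the latter
  costs n + 1 further times C T + B.\<close>

lemma riemann_sum_lipschitz_2d:
  fixes f :: "real \<Rightarrow> real \<Rightarrow> real"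
  assumes T: "T > 0" and C: "C \<ge> 0"
    and lip1: "\<And>x x' y. \<bar>f x y - f x' y\<bar> \<le> C * \<bar>x - x'\<bar>"
    and lip2: "\<And>x y y'. \<bar>f x y - f x y'\<bar> \<le> C * \<bar>y - y'\<bar>"
    and bd: "\<And>x y. \<bar>f x y\<bar> \<le> B"
  defines "I \<equiv> integral {0..T} (\<lambda>x. integral {0..T} (f x))"
  shows "\<bar>(\<Sum>j = 1..m. \<Sum>k = 1..n. f (T * real j / real (m + 1)) (T * real k / real (n + 1)))
      - real (m + 1) * real (n + 1) / T\<^sup>2 * I\<bar> \<le> real (m + n + 1) * (C * T + B)"
proof -
  define G where "G x = integral {0..T} (f x)" for x
  define S1 where "S1 x = (\<Sum>k = 1..n. f x (T * real k / real (n + 1)))" for x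
  define x where "x j = T * real j / real (m + 1)" for j
  have int: "f u integrable_on {0..T}" for u
    using C lip2
    by (intro integrable_continuous_real lipschitz_on_continuous_on[of C] lipschitz_onI)
      (auto simp: dist_real_def)
  have cont: "continuous_on {0..T} (f u)" for u
    using C lip2 by (intro lipschitz_on_continuous_on[of C] lipschitz_onI) (auto simp: dist_real_def)
  have G_lip: "\<bar>G u - G v\<bar> \<le> C * T * \<bar>u - v\<bar>" for u v
  proof -
    have "G u - G v = integral {0..T} (\<lambda>y. f u y - f v y)"
      unfolding G_def by (rule integral_diff[symmetric]) (rule int)+
    also have "\<bar>\<dots>\<bar> \<le> C * \<bar>u - v\<bar> * (T - 0)"
      unfolding real_norm_def[symmetric] using T lip1
      by (intro integral_bound continuous_intros cont) auto
    finally show ?thesis by (simp add: mult_ac)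
  qed
  have G_bd: "\<bar>G u\<bar> \<le> B * T" for u
    using integral_bound[OF _ cont, of u B] T bd unfolding G_def by simp
  have "\<bar>(\<Sum>j = 1..m. S1 (x j)) - real (n + 1) / T * (\<Sum>j = 1..m. G (x j))\<bar>
      = \<bar>\<Sum>j = 1..m. (S1 (x j) - real (n + 1) / T * G (x j))\<bar>"
    by (simp add: sum_subtractf sum_distrib_left)
  also have "\<dots> \<le> (\<Sum>j = 1..m. \<bar>S1 (x j) - real (n + 1) / T * G (x j)\<bar>)" by (rule sum_abs)
  also have "\<dots> \<le> (\<Sum>j = 1..m. C * T + B)"
    unfolding S1_def G_def using riemann_sum_lipschitz[OF T C lip2 bd] by (intro sum_mono)
  finally have 1: "\<bar>(\<Sum>j = 1..m. S1 (x j)) - real (n + 1) / T * (\<Sum>j = 1..m. G (x j))\<bar>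
      \<le> real m * (C * T + B)" by simp
  have "\<bar>(\<Sum>j = 1..m. G (x j)) - real (m + 1) / T * I\<bar> \<le> C * T * T + B * T"
    using riemann_sum_lipschitz[OF T _ G_lip G_bd, of m] C T unfolding x_def I_def G_def by simp
  then have "real (n + 1) / T * \<bar>(\<Sum>j = 1..m. G (x j)) - real (m + 1) / T * I\<bar>
      \<le> real (n + 1) / T * (C * T * T + B * T)"
    using T by (intro mult_left_mono) auto
  also have "\<dots> = real (n + 1) * (C * T + B)" using T by (simp add: field_simps)
  also have "real (n + 1) / T * \<bar>(\<Sum>j = 1..m. G (x j)) - real (m + 1) / T * I\<bar>
      = \<bar>real (n + 1) / T * (\<Sum>j = 1..m. G (x j)) - real (m + 1) * real (n + 1) / T\<^sup>2 * I\<bar>"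
  proof -
    have "real (n + 1) / T * \<bar>(\<Sum>j = 1..m. G (x j)) - real (m + 1) / T * I\<bar>
        = \<bar>real (n + 1) / T * ((\<Sum>j = 1..m. G (x j)) - real (m + 1) / T * I)\<bar>"
      using T by (subst abs_mult) simp
    also have "real (n + 1) / T * ((\<Sum>j = 1..m. G (x j)) - real (m + 1) / T * I)
        = real (n + 1) / T * (\<Sum>j = 1..m. G (x j)) - real (m + 1) * real (n + 1) / T\<^sup>2 * I"
      using T by (simp add: right_diff_distrib power2_eq_square mult_ac)
    finally show ?thesis .
  qed
  finally have 2: "\<bar>real (n + 1) / T * (\<Sum>j = 1..m. G (x j)) - real (m + 1) * real (n + 1) / T\<^sup>2 * I\<bar>
      \<le> real (n + 1) * (C * T + B)" .
  have "real (m + n + 1) * (C * T + B) = real m * (C * T + B) + real (n + 1) * (C * T + B)"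
    by (simp add: algebra_simps)
  moreover have tri: "\<bar>a - c\<bar> \<le> e1 + e2" if "\<bar>a - b\<bar> \<le> e1" "\<bar>b - c\<bar> \<le> e2" for a b c e1 e2 :: real
    using that by linarith
  ultimately show ?thesis using tri[OF 1 2] unfolding S1_def x_def by simp
qed

lemma riemann_sum_2d_tendsto:
  fixes f :: "real \<Rightarrow> real \<Rightarrow> real"
  assumes T: "T > 0" and C: "C \<ge> 0"
    and lip1: "\<And>x x' y. \<bar>f x y - f x' y\<bar> \<le> C * \<bar>x - x'\<bar>"
    and lip2: "\<And>x y y'. \<bar>f x y - f x y'\<bar> \<le> C * \<bar>y - y'\<bar>"
    and bd: "\<And>x y. \<bar>f x y\<bar> \<le> B"
  shows "((\<lambda>(m, n). (\<Sum>j = 1..m. \<Sum>k = 1..n. f (T * real j / real (m + 1)) (T * real k / real (n + 1)))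
      / (real m * real n)) \<longlongrightarrow> integral {0..T} (\<lambda>x. integral {0..T} (f x)) / T\<^sup>2)
    (sequentially \<times>\<^sub>F sequentially)"
proof -
  define I where "I = integral {0..T} (\<lambda>x. integral {0..T} (f x))"
  define S where "S m n = (\<Sum>j = 1..m. \<Sum>k = 1..n. f (T * real j / real (m + 1)) (T * real k / real (n + 1)))"
    for m n
  \<comment> \<open>The last summand pays for replacing (m + 1)(n + 1) by mn, a difference of m + n
    + 1.\<close>
  define K where "K = C * T + B + \<bar>I\<bar> / T\<^sup>2"
  have bound: "\<bar>S m n / (real m * real n) - I / T\<^sup>2\<bar> \<le> K * (1 / real n + 1 / real m + 1 / real m * (1 / real n))"
    if "m \<ge> 1" "n \<ge> 1" for m n
  proof -
    have mn: "real m * real n > 0" using that by simp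
    have "\<bar>S m n - real (m + 1) * real (n + 1) / T\<^sup>2 * I\<bar> \<le> real (m + n + 1) * (C * T + B)"
      unfolding S_def I_def by (rule riemann_sum_lipschitz_2d[OF T C lip1 lip2 bd])
    moreover have "real (m + 1) * real (n + 1) / T\<^sup>2 * I - real m * real n * (I / T\<^sup>2)
        = real (m + n + 1) * (I / T\<^sup>2)"
      by (simp add: algebra_simps add_divide_distrib)
    moreover have "\<bar>real (m + n + 1) * (I / T\<^sup>2)\<bar> = real (m + n + 1) * (\<bar>I\<bar> / T\<^sup>2)"
      by (simp add: abs_mult)
    moreover have "real (m + n + 1) * K = real (m + n + 1) * (C * T + B) + real (m + n + 1) * (\<bar>I\<bar> / T\<^sup>2)"
      unfolding K_def by (simp only: distrib_left)
    moreover have "\<bar>a - c\<bar> \<le> k"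
      if "\<bar>a - b\<bar> \<le> e1" "b - c = d" "\<bar>d\<bar> = e2" "k = e1 + e2" for a b c d e1 e2 k :: real
      using that by linarith
    ultimately have "\<bar>S m n - real m * real n * (I / T\<^sup>2)\<bar> \<le> real (m + n + 1) * K" by blast
    then have "\<bar>S m n - real m * real n * (I / T\<^sup>2)\<bar> / (real m * real n)
        \<le> real (m + n + 1) * K / (real m * real n)"
      using mn by (intro divide_right_mono) auto
    also have "real (m + n + 1) * K / (real m * real n)
        = K * (1 / real n + 1 / real m + 1 / real m * (1 / real n))"
      using that by (simp add: field_simps)
    also have "\<bar>S m n - real m * real n * (I / T\<^sup>2)\<bar> / (real m * real n)
        = \<bar>S m n / (real m * real n) - I / T\<^sup>2\<bar>"
    proof -
      have "S m n / (real m * real n) - I / T\<^sup>2 = (S m n - real m * real n * (I / T\<^sup>2)) / (real m * real n)"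
        using that by (simp add: diff_divide_distrib)
      then show ?thesis using mn by (simp only: abs_divide abs_of_pos)
    qed
    finally show ?thesis .
  qed
  let ?F = "sequentially \<times>\<^sub>F sequentially"
  have l1: "((\<lambda>p. 1 / real (fst p)) \<longlongrightarrow> 0) ?F"
    by (rule filterlim_compose[OF lim_1_over_n filterlim_fst])
  have l2: "((\<lambda>p. 1 / real (snd p)) \<longlongrightarrow> 0) ?F"
    by (rule filterlim_compose[OF lim_1_over_n filterlim_snd])
  have "((\<lambda>p. K * (1 / real (snd p) + 1 / real (fst p) + 1 / real (fst p) * (1 / real (snd p))))
      \<longlongrightarrow> K * (0 + 0 + 0 * 0)) ?F"
    by (intro tendsto_intros l1 l2)
  then have "((\<lambda>p. K * (1 / real (snd p) + 1 / real (fst p) + 1 / real (fst p) * (1 / real (snd p))))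
      \<longlongrightarrow> 0) ?F" by simp
  moreover have "\<forall>\<^sub>F p in ?F. norm (S (fst p) (snd p) / (real (fst p) * real (snd p)) - I / T\<^sup>2)
      \<le> K * (1 / real (snd p) + 1 / real (fst p) + 1 / real (fst p) * (1 / real (snd p)))"
    unfolding eventually_prod_sequentially real_norm_def using bound by (intro exI[of _ 1]) simp
  ultimately have "((\<lambda>p. S (fst p) (snd p) / (real (fst p) * real (snd p)) - I / T\<^sup>2) \<longlongrightarrow> 0) ?F"
    by (rule Lim_null_comparison[rotated])
  then show ?thesis
    unfolding S_def I_def split_beta by (rule LIM_zero_cancel)
qed

section \<open>The logarithmic symbol and its integral\<close>

definition log_symbol :: "real \<Rightarrow> real \<Rightarrow> real \<Rightarrow> real" where
  "log_symbol z x y = ln (z\<^sup>2 + 4 * (cos x)\<^sup>2 + 4 * (cos y)\<^sup>2)"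

lemma log_symbol_commute: "log_symbol z x y = log_symbol z y x"
  unfolding log_symbol_def by (simp add: algebra_simps)

text \<open>The derivative in x is -8 cos t sin t over a denominator of at least z^2; symmetry gives
  the bound in the other variable.\<close>

lemma log_symbol_lipschitz:
  assumes z: "z > 0"
  shows "\<bar>log_symbol z x y - log_symbol z x' y\<bar> \<le> 8 / z\<^sup>2 * \<bar>x - x'\<bar>"
proof -
  have pos: "z\<^sup>2 \<le> z\<^sup>2 + 4 * (cos t)\<^sup>2 + 4 * (cos y)\<^sup>2" "0 < z\<^sup>2 + 4 * (cos t)\<^sup>2 + 4 * (cos y)\<^sup>2" for t
    using z by (auto intro!: add_pos_nonneg)
  have deriv: "((\<lambda>x. log_symbol z x y) has_field_derivative
      1 / (z\<^sup>2 + 4 * (cos t)\<^sup>2 + 4 * (cos y)\<^sup>2) * - (8 * (cos t * sin t))) (at t within UNIV)" for t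
    unfolding log_symbol_def using pos(2)[of t] by (auto intro!: derivative_eq_intros)
  have "norm (log_symbol z x y - log_symbol z x' y) \<le> 8 / z\<^sup>2 * norm (x - x')"
  proof (rule field_differentiable_bound[OF convex_UNIV deriv])
    fix t :: real
    have "\<bar>cos t * sin t\<bar> \<le> 1 * 1"
      unfolding abs_mult by (intro mult_mono abs_cos_le_one abs_sin_le_one) auto
    then have "8 * \<bar>cos t * sin t\<bar> / (z\<^sup>2 + 4 * (cos t)\<^sup>2 + 4 * (cos y)\<^sup>2) \<le> 8 / z\<^sup>2"
      using pos[of t] z by (intro frac_le) auto
    then show "norm (1 / (z\<^sup>2 + 4 * (cos t)\<^sup>2 + 4 * (cos y)\<^sup>2) * - (8 * (cos t * sin t))) \<le> 8 / z\<^sup>2"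
      using pos(2)[of t] by (simp add: abs_mult)
  qed auto
  then show ?thesis by simp
qed

lemma log_symbol_bound:
  assumes z: "z > 0"
  shows "\<bar>log_symbol z x y\<bar> \<le> \<bar>ln (z\<^sup>2)\<bar> + \<bar>ln (z\<^sup>2 + 8)\<bar>"
proof -
  have "0 \<le> (cos x)\<^sup>2" "(cos x)\<^sup>2 \<le> 1" "0 \<le> (cos y)\<^sup>2" "(cos y)\<^sup>2 \<le> 1"
    by (auto simp: abs_square_le_1)
  moreover have "0 < z\<^sup>2" using z by simp
  ultimately have "ln (z\<^sup>2) \<le> log_symbol z x y" "log_symbol z x y \<le> ln (z\<^sup>2 + 8)"
    unfolding log_symbol_def by (intro ln_mono; linarith)+
  then show ?thesis by linarith
qed

definition log_symbol_integral :: "real \<Rightarrow> real" where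
  "log_symbol_integral z = integral {0..pi} (\<lambda>x. integral {0..pi} (log_symbol z x))"

text \<open>Leibniz's rule is applied once, to the integral over the square, with the parameter in
  the positive half line, where the derivative is jointly continuous; Fubini translates to iterated
  integrals.\<close>

lemma log_symbol_integral_has_derivative:
  assumes z: "z > 0"
  shows "(log_symbol_integral has_real_derivative
    integral {0..pi} (\<lambda>x. integral {0..pi} (\<lambda>y. 2 * z / (z\<^sup>2 + 4 * (cos x)\<^sup>2 + 4 * (cos y)\<^sup>2)))) (at z)"
proof -
  let ?Q = "cbox (0, 0) (pi, pi) :: (real \<times> real) set"
  have ne: "w\<^sup>2 + 4 * (cos x)\<^sup>2 + 4 * (cos y)\<^sup>2 \<noteq> 0" "0 < w\<^sup>2 + 4 * (cos x)\<^sup>2 + 4 * (cos y)\<^sup>2"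
    if "w > 0" for w x y :: real
  proof -
    show "0 < w\<^sup>2 + 4 * (cos x)\<^sup>2 + 4 * (cos y)\<^sup>2" using that by (auto intro!: add_pos_nonneg)
    then show "w\<^sup>2 + 4 * (cos x)\<^sup>2 + 4 * (cos y)\<^sup>2 \<noteq> 0" by simp
  qed
  have cont: "continuous_on ?Q (\<lambda>p. log_symbol w (fst p) (snd p))" if "w > 0" for w
    unfolding log_symbol_def using ne[OF that] by (intro continuous_intros) auto
  have iter: "integral ?Q (\<lambda>p. log_symbol w (fst p) (snd p)) = log_symbol_integral w" if "w > 0" for w
    using integral_prod_continuous[OF cont[OF that]] unfolding log_symbol_integral_def box_real
    by simp
  let ?D = "\<lambda>w p. 2 * w / (w\<^sup>2 + 4 * (cos (fst p))\<^sup>2 + 4 * (cos (snd p))\<^sup>2) :: real"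
  have "((\<lambda>w. integral ?Q (\<lambda>p. log_symbol w (fst p) (snd p))) has_field_derivative
      integral ?Q (?D z)) (at z within {0<..})"
  proof (rule leibniz_rule_field_derivative)
    fix w :: real and p :: "real \<times> real" assume "w \<in> {0<..}"
    then have "w > 0" by simp
    then show "((\<lambda>w. log_symbol w (fst p) (snd p)) has_field_derivative ?D w p) (at w within {0<..})"
      unfolding log_symbol_def using ne[OF \<open>w > 0\<close>] by (auto intro!: derivative_eq_intros)
  next
    fix w :: real assume "w \<in> {0<..}"
    then show "(\<lambda>p. log_symbol w (fst p) (snd p)) integrable_on ?Q"
      by (intro integrable_continuous cont) simp
  next
    show "continuous_on ({0<..} \<times> ?Q) (\<lambda>(w, p). ?D w p)"
      unfolding split_beta using ne by (intro continuous_intros) auto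
  qed (use z in auto)
  moreover have "integral ?Q (?D z)
      = integral {0..pi} (\<lambda>x. integral {0..pi} (\<lambda>y. 2 * z / (z\<^sup>2 + 4 * (cos x)\<^sup>2 + 4 * (cos y)\<^sup>2)))"
  proof -
    have "continuous_on ?Q (?D z)" using ne[OF z] by (intro continuous_intros) auto
    from integral_prod_continuous[OF this] show ?thesis unfolding box_real by simp
  qed
  moreover have "at z within {0<..} = at z" using z by (intro at_within_open) auto
  ultimately have "((\<lambda>w. integral ?Q (\<lambda>p. log_symbol w (fst p) (snd p))) has_real_derivative
      integral {0..pi} (\<lambda>x. integral {0..pi} (\<lambda>y. 2 * z / (z\<^sup>2 + 4 * (cos x)\<^sup>2 + 4 * (cos y)\<^sup>2)))) (at z)"
    by simp
  then show ?thesis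
    by (rule has_field_derivative_transform_within_open[of _ _ _ "{0<..}"]) (use z iter in auto)
qed

section \<open>The thermodynamic limit and its derivative\<close>

lemma both_even_at_top_neq_bot: "both_even_at_top \<noteq> bot"
proof
  assume "both_even_at_top = bot"
  then have "eventually (\<lambda>_. False) both_even_at_top" by simp
  then have "\<exists>N. \<forall>m\<ge>N. \<forall>n\<ge>N. (n, m) \<in> {(m :: nat, n :: nat). even m \<and> even n} \<longrightarrow> False"
    unfolding both_even_at_top_def eventually_inf_principal eventually_prod_sequentially .
  then obtain N where N: "\<forall>m\<ge>N. \<forall>n\<ge>N. (n, m) \<in> {(m :: nat, n :: nat). even m \<and> even n} \<longrightarrow> False"
    by (rule exE)
  from N[rule_format, of "2 * N" "2 * N"] show False by simp
qed

lemma free_energy_eq_log_symbol_integral: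
  assumes z: "z > 0"
  shows "free_energy 1 1 z = log_symbol_integral z / (2 * pi\<^sup>2)"
proof -
  let ?S = "\<lambda>m n. \<Sum>j = 1..m. \<Sum>k = 1..n.
    log_symbol z (pi * real j / real (m + 1)) (pi * real k / real (n + 1))"
  have ln_Z: "ln (grid_partition_function m n 1 1 z) = ?S m n / 2" for m n
  proof -
    let ?Z = "grid_partition_function m n 1 1 z"
    let ?ev = "\<lambda>q. z\<^sup>2 + (eigen_freq m (fst q))\<^sup>2 + (eigen_freq n (snd q))\<^sup>2"
    have pos: "0 < ?ev q" for q using z by (auto intro!: add_pos_nonneg)
    have "0 < ?Z\<^sup>2"
      unfolding grid_partition_function_square by (rule prod_pos) (rule pos)
    \<comment> \<open>Positivity of the square says only that Z is nonzero, which is enough for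
      \<open>ln_mult\<close>; this is the origin of the factor 1/2 in the free energy.\<close>
    then have "2 * ln ?Z = ln (?Z\<^sup>2)" by (simp add: power2_eq_square ln_mult)
    also have "\<dots> = (\<Sum>q\<in>{1..m} \<times> {1..n}. ln (?ev q))"
      unfolding grid_partition_function_square by (rule ln_prod[OF _ less_imp_neq[OF pos, symmetric]]) simp
    also have "\<dots> = ?S m n"
      unfolding sum.cartesian_product
      by (intro sum.cong) (auto simp: log_symbol_def eigen_freq_def power_mult_distrib)
    finally show ?thesis by simp
  qed
  have "((\<lambda>(m, n). ?S m n / (real m * real n)) \<longlongrightarrow>
      integral {0..pi} (\<lambda>x. integral {0..pi} (log_symbol z x)) / pi\<^sup>2) (sequentially \<times>\<^sub>F sequentially)"
  proof (rule riemann_sum_2d_tendsto[OF pi_gt_zero])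
    show "0 \<le> 8 / z\<^sup>2" by simp
    show "\<bar>log_symbol z x y - log_symbol z x y'\<bar> \<le> 8 / z\<^sup>2 * \<bar>y - y'\<bar>" for x y y'
      using log_symbol_lipschitz[OF z, of y x y'] by (simp only: log_symbol_commute[of z x])
  qed (rule log_symbol_lipschitz[OF z] log_symbol_bound[OF z])+
  then have "((\<lambda>p. 1 / 2 * (?S (fst p) (snd p) / (real (fst p) * real (snd p)))) \<longlongrightarrow>
      1 / 2 * (log_symbol_integral z / pi\<^sup>2)) both_even_at_top"
    unfolding both_even_at_top_def log_symbol_integral_def split_beta
    by (intro tendsto_mult_left tendsto_mono[OF inf_le1])
  then have "((\<lambda>(m, n). ln (grid_partition_function m n 1 1 z) / (real m * real n)) \<longlongrightarrow>
      log_symbol_integral z / (2 * pi\<^sup>2)) both_even_at_top"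
    by (simp add: ln_Z case_prod_unfold mult.assoc)
  then show ?thesis
    unfolding free_energy_def by (rule tendsto_Lim[OF both_even_at_top_neq_bot])
qed

lemma deriv_free_energy:
  assumes z: "z > 0"
  shows "deriv (\<lambda>x. free_energy 1 1 x) z
    = 2 * z / (pi * (4 + z\<^sup>2)) * complete_elliptic_K (4 / (4 + z\<^sup>2))"
proof -
  have "((\<lambda>x. log_symbol_integral x / (2 * pi\<^sup>2)) has_real_derivative
      integral {0..pi} (\<lambda>x. integral {0..pi} (\<lambda>y. 2 * z / (z\<^sup>2 + 4 * (cos x)\<^sup>2 + 4 * (cos y)\<^sup>2)))
        / (2 * pi\<^sup>2)) (at z)"
    by (rule DERIV_cdivide[OF log_symbol_integral_has_derivative[OF z]])
  then have "((\<lambda>x. free_energy 1 1 x) has_real_derivative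
      integral {0..pi} (\<lambda>x. integral {0..pi} (\<lambda>y. 2 * z / (z\<^sup>2 + 4 * (cos x)\<^sup>2 + 4 * (cos y)\<^sup>2)))
        / (2 * pi\<^sup>2)) (at z)"
    \<comment> \<open>The integral formula for the free energy is known on the open half line around
      z, which suffices for the derivative.\<close>
    by (rule has_field_derivative_transform_within_open[of _ _ _ "{0<..}"])
      (use z free_energy_eq_log_symbol_integral in auto)
  then have "deriv (\<lambda>x. free_energy 1 1 x) z
    = integral {0..pi} (\<lambda>x. integral {0..pi} (\<lambda>y. 2 * z / (z\<^sup>2 + 4 * (cos x)\<^sup>2 + 4 * (cos y)\<^sup>2)))
        / (2 * pi\<^sup>2)"
    by (rule DERIV_imp_deriv)
  also have "integral {0..pi} (\<lambda>x. integral {0..pi} (\<lambda>y. 2 * z / (z\<^sup>2 + 4 * (cos x)\<^sup>2 + 4 * (cos y)\<^sup>2)))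
    = integral {0..pi} (\<lambda>x. integral {0..pi} (\<lambda>y.
        2 * z * (1 / ((4 + z\<^sup>2) + 2 * cos (2 * x) + 2 * cos (2 * y)))))"
  proof -
    \<comment> \<open>Each 4 cos^2 is 2 + 2 cos of the double angle; the two constants make up the 4
      in s = 4 + z^2, and hence the modulus 4 / s.\<close>
    have eq: "z\<^sup>2 + 4 * (cos x)\<^sup>2 + 4 * (cos y)\<^sup>2 = (4 + z\<^sup>2) + 2 * cos (2 * x) + 2 * cos (2 * y)" for x y
      by (simp add: cos_double_cos)
    show ?thesis by (simp only: eq times_divide_eq_right mult_1_right)
  qed
  also have "\<dots> = 2 * z * (2 * pi / (4 + z\<^sup>2) * complete_elliptic_K (4 / (4 + z\<^sup>2)))"
    using integral_lattice_green[of "4 + z\<^sup>2"] z by (simp only: integral_mult_right) simp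
  also have "\<dots> / (2 * pi\<^sup>2) = 2 * z / (pi * (4 + z\<^sup>2)) * complete_elliptic_K (4 / (4 + z\<^sup>2))"
    by (simp add: power2_eq_square)
  finally show ?thesis .
qed

theorem mainTheorem10:
  fixes z :: real
  assumes "z > 0"
  shows "entropy 1 1 z =
           free_energy 1 1 z
           - 2 * z\<^sup>2 * ln z / (pi * (4 + z\<^sup>2)) * complete_elliptic_K (4 / (4 + z\<^sup>2))"
  unfolding entropy_def deriv_free_energy[OF assms] by (simp add: power2_eq_square)

end
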